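(* Let $P$ be a connected projection of a link $L$ with all-$A$ dessin $\mathbb{D}:=\mathbb{D}(A)$, and let $$\langle P\rangle=\sum_{\mathbb{H}\subset\mathbb{D}}A^{e(\mathbb{D})-2e(\mathbb{H})}(-A^2-A^{-2})^{f(\mathbb{H})-1}$$ be the spanning sub-dessin expansion of the Kauffman bracket of $P$ (sum over all spanning sub-dessins $\mathbb{H}$ of $\mathbb{D}$). (1) For $l\ge 0$ let $a_{M-l}$ denote the coefficient of $A^{e(\mathbb{D})+2v(\mathbb{D})-2-4l}$ in the Kauffman bracket $\langle P\rangle$. Then the term $a_{M-l}$ only depends on spanning sub-dessins $\mathbb{H}\subset\mathbb{D}$ of genus $g(\mathbb{H})\le l$. (2) The highest term is given by $$a_M=\sum_{\mathbb{H}\subset\mathbb{D},\ g(\mathbb{H})=0=k(\mathbb{H})-v(\mathbb{D})}(-1)^{v(\mathbb{D})+e(\mathbb{H})-1}.$$ In particular, if $\mathbb{D}$ does not contain any loops then $a_M=(-1)^{v(\mathbb{D})-1}$, and the only contribution comes from $\mathbb{H}_0$, the spanning sub-dessin that contains no edges.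
   Context: A dessin (d'enfant; combinatorial map, oriented ribbon graph) is a finite multigraph (loops and multiple edges allowed) with a cyclic order on the edge-ends at each vertex; equivalently a graph embedded in an orientable surface so that all complementary regions (faces) are disks. For a dessin $\mathbb{D}$, let $v(\mathbb{D}),e(\mathbb{D}),f(\mathbb{D}),k(\mathbb{D})$ denote the numbers of vertices, edges, faces and connected components; faces are counted as boundary components of the associated ribbon surface (an isolated vertex has one face). The genus is $g(\mathbb{D})=\frac{2k(\mathbb{D})-v(\mathbb{D})+e(\mathbb{D})-f(\mathbb{D})}{2}$. A spanning sub-dessin $\mathbb{H}\subset\mathbb{D}$ is obtained by deleting edges (keeping all vertices), with induced cyclic orders; $e(\mathbb{H}),f(\mathbb{H}),k(\mathbb{H}),g(\mathbb{H})$ are computed for $\mathbb{H}$ as a dessin in its own right. All-$A$ dessin $\mathbb{D}(A)$ of a link diagram $P$: at each crossing the $A$-splicing is the smoothing that joins the two regions swept out when the over-strand is rotated counterclockwise onto the under-strand (the $B$-splicing is the other smoothing). Splice every crossing by its $A$-splicing to get disjoint circles in the plane, together with one arc per crossing recording the splice. Vertices of $\mathbb{D}(A)$ are the circles, edges are the crossings (arcs). Orient each circle clockwise or anti-clockwise according to whether it lies inside an odd or even number of the circles, respectively; the cyclic order at a vertex is the order in which arc-ends are met along the oriented circle. The Kauffman bracket $\langle P\rangle\in\mathbb{Z}[A,A^{-1}]$ is normalized so that the crossingless diagram of the unknot has bracket $1$: $\langle\text{crossing}\rangle=A\langle A\text{-splicing}\rangle+A^{-1}\langle B\text{-splicing}\rangle$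 and an extra disjoint circle multiplies the bracket by $-A^2-A^{-2}$. The displayed sub-dessin expansion of $\langle P\rangle$ is a previously known formula. Here $a_M$ means $a_{M-0}$, the coefficient of $A^{e(\mathbb{D})+2v(\mathbb{D})-2}$ (which may be zero). *)

theory Defs
  imports
    Complex_Main
    "HOL-Library.Poly_Mapping"
    "HOL-Combinatorics.Orbits"
begin

text \<open>
  The first point of \<open>S\<close> met when \<open>f\<close> is iterated, at least once, from \<open>x\<close>.  If \<open>f\<close> is a cyclic
  order then this is the cyclic order it induces on \<open>S\<close>.
\<close>

definition first_return :: "('a \<Rightarrow> 'a) \<Rightarrow> 'a set \<Rightarrow> 'a \<Rightarrow> 'a" where
  "first_return f S x = (f ^^ (LEAST n. 0 < n \<and> (f ^^ n) x \<in> S)) x"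

definition equiv_closure :: "('a \<times> 'a) set \<Rightarrow> ('a \<times> 'a) set" where
  "equiv_closure R = (R \<union> R\<inverse>)\<^sup>*"


section \<open>Dessins\<close>

text \<open>
  The two ends of an edge \<open>e\<close> are \<open>(e, True)\<close> and \<open>(e, False)\<close>.  In a dessin the sets of vertices and
  edges are finite, \<open>end_vertex\<close> maps ends of edges to vertices, and \<open>next_end\<close> permutes the ends of
  edges in such a way that the ends at any non-isolated vertex form one cycle of \<open>next_end\<close>.
\<close>

record ('v, 'e) dessin =
  verts :: "'v set"
  edges :: "'e set"
  end_vertex :: "'e \<times> bool \<Rightarrow> 'v"
  next_end :: "'e \<times> bool \<Rightarrow> 'e \<times> bool"

definition edge_ends :: "('v, 'e) dessin \<Rightarrow> ('e \<times> bool) set" where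
  "edge_ends D = edges D \<times> UNIV"

definition isolated_verts :: "('v, 'e) dessin \<Rightarrow> 'v set" where
  "isolated_verts D = verts D - end_vertex D ` edge_ends D"

text \<open>
  A boundary component of the ribbon surface follows one side of a band to its other end and then
  the boundary of the vertex disk to the next band.
\<close>

definition face_step :: "('v, 'e) dessin \<Rightarrow> 'e \<times> bool \<Rightarrow> 'e \<times> bool" where
  "face_step D = (\<lambda>(e, b). next_end D (e, \<not> b))"

definition num_verts :: "('v, 'e) dessin \<Rightarrow> nat" where
  "num_verts D = card (verts D)"

definition num_edges :: "('v, 'e) dessin \<Rightarrow> nat" where
  "num_edges D = card (edges D)"

definition num_faces :: "('v, 'e) dessin \<Rightarrow> nat" where
  "num_faces D = card (orbit (face_step D) ` edge_ends D) + card (isolated_verts D)"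

definition adjacency :: "('v, 'e) dessin \<Rightarrow> ('v \<times> 'v) set" where
  "adjacency D = {(end_vertex D (e, True), end_vertex D (e, False)) | e. e \<in> edges D}"

definition num_components :: "('v, 'e) dessin \<Rightarrow> nat" where
  "num_components D = card (verts D // equiv_closure (adjacency D))"

definition genus :: "('v, 'e) dessin \<Rightarrow> real" where
  "genus D = (2 * real (num_components D) - real (num_verts D)
              + real (num_edges D) - real (num_faces D)) / 2"

definition has_loop :: "('v, 'e) dessin \<Rightarrow> bool" where
  "has_loop D \<longleftrightarrow> (\<exists>e\<in>edges D. end_vertex D (e, True) = end_vertex D (e, False))"

definition spanning_subdessin :: "('v, 'e) dessin \<Rightarrow> 'e set \<Rightarrow> ('v, 'e) dessin" where
  "spanning_subdessin D F =
     \<lparr>verts = verts D, edges = F, end_vertex = end_vertex D,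
      next_end = first_return (next_end D) (F \<times> UNIV)\<rparr>"

definition spanning_subdessins :: "('v, 'e) dessin \<Rightarrow> ('v, 'e) dessin set" where
  "spanning_subdessins D = spanning_subdessin D ` Pow (edges D)"


section \<open>Link diagrams\<close>

text \<open>
  A diagram is a plane graph with 4-valent crossings and bivalent vertices (joins), given as a
  combinatorial map on its half-edges.  A crossing \<open>(a, b, c, d)\<close> lists its half-edges
  counterclockwise; \<open>a\<close> and \<open>c\<close> belong to the under-strand, \<open>b\<close> and \<open>d\<close> to the over-strand.  A join
  is a marked point on a strand: joins are what is left of a spliced crossing, and they allow
  components without crossings, so the crossingless unknot is one join with \<open>opp\<close> exchanging
  its two half-edges.  \<open>opp h\<close> is the other half of the edge containing \<open>h\<close>.  The map
  determines the diagram on the sphere; the half-edge \<open>outer\<close> fixes it in the plane: the face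
  to the right of \<open>outer\<close>, seen from the vertex of \<open>outer\<close>, is the unbounded one.
\<close>

type_synonym 'h crossing = "'h \<times> 'h \<times> 'h \<times> 'h"

record 'h diagram =
  crossings :: "'h crossing list"
  joins :: "('h \<times> 'h) list"
  opp :: "'h \<Rightarrow> 'h"
  outer :: 'h

fun crossing_halves :: "'h crossing \<Rightarrow> 'h list" where
  "crossing_halves (a, b, c, d) = [a, b, c, d]"

definition join_halves :: "('h \<times> 'h) list \<Rightarrow> 'h list" where
  "join_halves js = concat (map (\<lambda>(a, b). [a, b]) js)"

definition half_list :: "'h diagram \<Rightarrow> 'h list" where
  "half_list P = concat (map crossing_halves (crossings P)) @ join_halves (joins P)"

definition halves :: "'h diagram \<Rightarrow> 'h set" where
  "halves P = set (half_list P)"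

fun crossing_rotation :: "'h crossing \<Rightarrow> ('h \<times> 'h) list" where
  "crossing_rotation (a, b, c, d) = [(a, b), (b, c), (c, d), (d, a)]"

text \<open>
  The other half-edge at the same join.
\<close>

definition partner :: "('h \<times> 'h) list \<Rightarrow> 'h \<Rightarrow> 'h" where
  "partner js h = the (map_of (js @ map prod.swap js) h)"

text \<open>
  The next half-edge counterclockwise at the same vertex.
\<close>

definition ccw :: "'h diagram \<Rightarrow> 'h \<Rightarrow> 'h" where
  "ccw P h = (if h \<in> set (join_halves (joins P)) then partner (joins P) h
              else the (map_of (concat (map crossing_rotation (crossings P))) h))"

text \<open>
  Walk along the edge of \<open>h\<close>, then leave the next vertex keeping the face on the right-hand side:
  the orbit of \<open>h\<close> is the face to the right of \<open>h\<close>.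
\<close>

definition right_face_step :: "'h diagram \<Rightarrow> 'h \<Rightarrow> 'h" where
  "right_face_step P h = ccw P (opp P h)"

definition wf_diagram :: "'h diagram \<Rightarrow> bool" where
  "wf_diagram P \<longleftrightarrow>
     distinct (half_list P) \<and>
     (\<forall>h\<in>halves P. opp P h \<in> halves P \<and> opp P h \<noteq> h \<and> opp P (opp P h) = h) \<and>
     outer P \<in> halves P"

definition connected_diagram :: "'h diagram \<Rightarrow> bool" where
  "connected_diagram P \<longleftrightarrow>
     (\<forall>h\<in>halves P. \<forall>h'\<in>halves P.
        (h, h') \<in> equiv_closure ({(x, ccw P x) | x. x \<in> halves P} \<union>
                                 {(x, opp P x) | x. x \<in> halves P}))"

text \<open>
  Euler's formula, for a connected diagram: vertices + faces = edges + 2.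
\<close>

definition planar_diagram :: "'h diagram \<Rightarrow> bool" where
  "planar_diagram P \<longleftrightarrow>
     (length (crossings P) + length (joins P)) + card (orbit (right_face_step P) ` halves P)
       = card (orbit (opp P) ` halves P) + 2"

definition connected_projection :: "'h diagram \<Rightarrow> bool" where
  "connected_projection P \<longleftrightarrow> wf_diagram P \<and> connected_diagram P \<and> planar_diagram P"


section \<open>The Kauffman bracket\<close>

text \<open>
  Rotating the over-strand \<open>b d\<close> of \<open>(a, b, c, d)\<close> counterclockwise sweeps out the corner between
  \<open>b\<close> and \<open>c\<close> and the corner between \<open>d\<close> and \<open>a\<close>.  The A-splicing merges these two corners, so
  it connects \<open>a\<close> with \<open>b\<close> and \<open>c\<close> with \<open>d\<close>.
\<close>

fun A_splice :: "'h crossing \<Rightarrow> ('h \<times> 'h) list" where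
  "A_splice (a, b, c, d) = [(a, b), (c, d)]"

fun B_splice :: "'h crossing \<Rightarrow> ('h \<times> 'h) list" where
  "B_splice (a, b, c, d) = [(b, c), (d, a)]"

text \<open>
  The circles of a crossingless diagram, as sets of half-edges.
\<close>

definition circle_rel :: "('h \<Rightarrow> 'h) \<Rightarrow> ('h \<times> 'h) list \<Rightarrow> ('h \<times> 'h) set" where
  "circle_rel op js = equiv_closure (set js \<union> {(h, op h) | h. h \<in> set (join_halves js)})"

definition circles :: "('h \<Rightarrow> 'h) \<Rightarrow> ('h \<times> 'h) list \<Rightarrow> 'h set set" where
  "circles op js = set (join_halves js) // circle_rel op js"

text \<open>
  Laurent polynomials in \<open>A\<close> with integer coefficients: finitely supported functions from
  exponents to coefficients.
\<close>

type_synonym laurent = "int \<Rightarrow>\<^sub>0 int"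

abbreviation coefficient :: "laurent \<Rightarrow> int \<Rightarrow> int" where
  "coefficient \<equiv> Poly_Mapping.lookup"

definition A_power :: "int \<Rightarrow> laurent" where
  "A_power k = Poly_Mapping.single k 1"

definition circle_value :: laurent where
  "circle_value = - A_power 2 - A_power (- 2)"

fun bracket :: "('h \<Rightarrow> 'h) \<Rightarrow> ('h \<times> 'h) list \<Rightarrow> 'h crossing list \<Rightarrow> laurent" where
  "bracket op js [] = circle_value ^ (card (circles op js) - 1)"
| "bracket op js (x # xs) =
     A_power 1 * bracket op (A_splice x @ js) xs + A_power (- 1) * bracket op (B_splice x @ js) xs"

definition kauffman_bracket :: "'h diagram \<Rightarrow> laurent" where
  "kauffman_bracket P = bracket (opp P) (joins P) (crossings P)"


section \<open>The all-A dessin\<close>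

definition all_A_joins :: "'h diagram \<Rightarrow> ('h \<times> 'h) list" where
  "all_A_joins P = concat (map A_splice (crossings P)) @ joins P"

definition A_circles :: "'h diagram \<Rightarrow> 'h set set" where
  "A_circles P = circles (opp P) (all_A_joins P)"

definition A_circle_of :: "'h diagram \<Rightarrow> 'h \<Rightarrow> 'h set" where
  "A_circle_of P h = circle_rel (opp P) (all_A_joins P) `` {h}"

text \<open>
  Half-edges \<open>h\<close> and \<open>h'\<close> are related iff the faces of \<open>P\<close> to their right lie in the same component
  of the plane minus the circle \<open>C\<close> of the all-A state.  One may stay in a face, cross an
  edge that is not on \<open>C\<close>, or pass between the two corners of a crossing that its A-splicing
  merges (the corner between \<open>b\<close> and \<open>c\<close> is to the right of \<open>c\<close>, that between \<open>d\<close> and \<open>a\<close> to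
  the right of \<open>a\<close>).
\<close>

definition same_side :: "'h diagram \<Rightarrow> 'h set \<Rightarrow> ('h \<times> 'h) set" where
  "same_side P C = equiv_closure
     ({(h, right_face_step P h) | h. h \<in> halves P} \<union>
      {(h, opp P h) | h. h \<in> halves P - C} \<union>
      {(a, c) | a b c d. (a, b, c, d) \<in> set (crossings P)})"

definition lies_inside :: "'h diagram \<Rightarrow> 'h set \<Rightarrow> 'h set \<Rightarrow> bool" where
  "lies_inside P C C' \<longleftrightarrow> C \<noteq> C' \<and> (\<forall>h\<in>C. (outer P, h) \<notin> same_side P C')"

definition nesting :: "'h diagram \<Rightarrow> 'h set \<Rightarrow> nat" where
  "nesting P C = card {C' \<in> A_circles P. lies_inside P C C'}"

text \<open>
  Traversing its circle by leaving along \<open>h\<close> goes clockwise iff the inside is to the right of \<open>h\<close>.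
\<close>

definition clockwise :: "'h diagram \<Rightarrow> 'h \<Rightarrow> bool" where
  "clockwise P h \<longleftrightarrow> (outer P, h) \<notin> same_side P (A_circle_of P h)"

definition positively_directed :: "'h diagram \<Rightarrow> 'h \<Rightarrow> bool" where
  "positively_directed P h \<longleftrightarrow> (clockwise P h \<longleftrightarrow> odd (nesting P (A_circle_of P h)))"

text \<open>
  Walk along the edge of \<open>h\<close> and leave the next vertex of the all-A state.
\<close>

definition travel :: "'h diagram \<Rightarrow> 'h \<Rightarrow> 'h" where
  "travel P h = partner (all_A_joins P) (opp P h)"

text \<open>
  The arc recording the A-splicing of \<open>(a, b, c, d)\<close> has one end on the strand \<open>a b\<close> and the
  other on the strand \<open>c d\<close>.
\<close>

fun arc_end_halves :: "'h crossing \<times> bool \<Rightarrow> 'h set" where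
  "arc_end_halves ((a, b, c, d), True) = {a, b}"
| "arc_end_halves ((a, b, c, d), False) = {c, d}"

definition arc_ends :: "'h diagram \<Rightarrow> ('h crossing \<times> bool) set" where
  "arc_ends P = set (crossings P) \<times> UNIV"

definition crossing_half_set :: "'h diagram \<Rightarrow> 'h set" where
  "crossing_half_set P = (\<Union>x\<in>arc_ends P. arc_end_halves x)"

definition arc_end_of :: "'h diagram \<Rightarrow> 'h \<Rightarrow> 'h crossing \<times> bool" where
  "arc_end_of P h = (THE x. x \<in> arc_ends P \<and> h \<in> arc_end_halves x)"

text \<open>
  The half-edge along which the oriented circle departs from an arc-end.
\<close>

definition departure :: "'h diagram \<Rightarrow> 'h crossing \<times> bool \<Rightarrow> 'h" where
  "departure P x = (THE h. h \<in> arc_end_halves x \<and> positively_directed P h)"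

definition next_arc_end :: "'h diagram \<Rightarrow> 'h crossing \<times> bool \<Rightarrow> 'h crossing \<times> bool" where
  "next_arc_end P x =
     arc_end_of P (first_return (travel P) (crossing_half_set P) (departure P x))"

definition arc_end_circle :: "'h diagram \<Rightarrow> 'h crossing \<times> bool \<Rightarrow> 'h set" where
  "arc_end_circle P x = (THE C. C \<in> A_circles P \<and> arc_end_halves x \<subseteq> C)"

definition all_A_dessin :: "'h diagram \<Rightarrow> ('h set, 'h crossing) dessin" where
  "all_A_dessin P =
     \<lparr>verts = A_circles P, edges = set (crossings P),
      end_vertex = arc_end_circle P, next_end = next_arc_end P\<rparr>"


section \<open>The spanning sub-dessin expansion\<close>

definition expansion_term :: "('v, 'e) dessin \<Rightarrow> ('v, 'e) dessin \<Rightarrow> laurent" where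
  "expansion_term D H =
     A_power (int (num_edges D) - 2 * int (num_edges H)) * circle_value ^ (num_faces H - 1)"

definition exponent_M :: "('v, 'e) dessin \<Rightarrow> int" where
  "exponent_M D = int (num_edges D) + 2 * int (num_verts D) - 2"

end

theory Submission
  imports Defs
begin

text \<open>
  The expansion rests on one bijection.  For a set $F$ of crossings, consider the state with
  B-splicings at $F$ and A-splicings elsewhere.  Its circles are the boundary components of the ribbon
  surface made of the all-A circles as disks and the crossings in $F$ as bands, that is, the faces of
  the spanning sub-dessin $H$ with edge set $F$ (\<open>num_faces_spanning_subdessin\<close>).  Resolving all
  crossings turns the bracket into a sum over such states (\<open>bracket_expansion\<close>).

  The bijection needs orientations.  A face of a dessin runs through its bands in a fixed pattern,
  which the circle of the state follows only if the two all-A circles at a crossing are directed so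
  that the B-splicing respects the directions.  That alternating directions by nesting depth have this
  property (\<open>positively_directed_crossing\<close>) is a fact about the plane: each circle has
  exactly two sides, one of which contains the unbounded face.  For combinatorial diagrams this Jordan
  curve theorem follows from Euler's formula, as the planar map has no homology in degree 1
  (\<open>planar_even_set_is_boundary\<close>): a circle is an even set of edges, so it bounds a set of
  faces.  Once directed, circles and faces are both orbits of permutations, related by first
  returns to the arc-ends in $F$ (\<open>card_orbits_switched\<close>).

  The statements on coefficients compare degrees.  The term of $H$ has highest exponent
  $e(D) - 2e(H) + 2f(H) - 2$ with coefficient $(-1)^{f(H)-1}$.  In terms of the genus this exponent is
  $M - 4g(H) - 4(v(D) - k(H))$, where $M = e(D) + 2v(D) - 2$; as $k(H) \<le> v(D)$, the term does not
  reach the exponent $M - 4l$ if $g(H) > l$.  For $l = 0$ the genus must moreover not be negative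
  (\<open>genus_bound\<close>); then only $g(H) = 0$ and $k(H) = v(D)$ contribute, with $f(H) = v(D) + e(H)$.  A
  sub-dessin with an edge that is not a loop has fewer components than vertices, which leaves only
  $H_0$ if there are no loops.
\<close>

section \<open>Classes of equivalence closures\<close>

text \<open>
  Circles, faces, components and orbits are all counted as the values of a function on some set.
  Two such counts agree when the functions identify the same points, and this is how they are
  compared throughout.
\<close>

lemma card_image_eq_if_same_kernel:
  assumes "\<And>x y. x \<in> A \<Longrightarrow> y \<in> A \<Longrightarrow> f x = f y \<longleftrightarrow> g x = g y"
  shows "card (f ` A) = card (g ` A)"
proof -
  define h where "h z = g (inv_into A f z)" for z
  have h: "h (f x) = g x" if "x \<in> A" for x
    using assms[of "inv_into A f (f x)" x] that
    by (simp add: h_def inv_into_into f_inv_into_f)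
  have "inj_on h (f ` A)"
    using assms by (auto simp: inj_on_def h)
  moreover have "h ` f ` A = g ` A"
    by (auto simp: h image_iff)
  ultimately show ?thesis
    by (metis card_image)
qed

lemma quotient_eq_image: "V // R = (\<lambda>x. R `` {x}) ` V"
  by (auto simp: quotient_def)

lemma equiv_closure_refl [simp]: "(x, x) \<in> equiv_closure R"
  by (simp add: equiv_closure_def)

lemma equiv_closure_sym: "(x, y) \<in> equiv_closure R \<Longrightarrow> (y, x) \<in> equiv_closure R"
  unfolding equiv_closure_def by (meson sym_Un_converse sym_rtrancl symD)

lemma equiv_closure_trans:
  "(x, y) \<in> equiv_closure R \<Longrightarrow> (y, z) \<in> equiv_closure R \<Longrightarrow> (x, z) \<in> equiv_closure R"
  unfolding equiv_closure_def by (rule rtrancl_trans)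

lemma equiv_closure_base: "(x, y) \<in> R \<Longrightarrow> (x, y) \<in> equiv_closure R"
  by (auto simp: equiv_closure_def)

text \<open>
  Every argument along a path is reduced by this rule, or by its special case
  \<open>equiv_closure_invariant\<close>, to a look at single edges.
\<close>

lemma equiv_closure_map:
  assumes "(x, y) \<in> equiv_closure R"
    and "\<And>u v. (u, v) \<in> R \<Longrightarrow> (g u, g v) \<in> equiv_closure S"
  shows "(g x, g y) \<in> equiv_closure S"
  using assms(1) unfolding equiv_closure_def[of R]
proof (induction rule: rtrancl_induct)
  case (step y z)
  then have "(y, z) \<in> R \<or> (z, y) \<in> R" by blast
  then have "(g y, g z) \<in> equiv_closure S"
    using assms(2) equiv_closure_sym[of "g z" "g y" S] by blast
  with step.IH show ?case
    by (rule equiv_closure_trans)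
qed simp

lemma equiv_closure_mono:
  assumes "(x, y) \<in> equiv_closure R" and "R \<subseteq> equiv_closure S"
  shows "(x, y) \<in> equiv_closure S"
  using assms(1) by (rule equiv_closure_map[where g = "\<lambda>x. x"]) (use assms(2) in blast)

lemma equiv_closure_empty: "equiv_closure {} = Id"
  by (simp add: equiv_closure_def)

lemma equiv_closure_invariant:
  assumes "(x, y) \<in> equiv_closure R"
    and "\<And>u v. (u, v) \<in> R \<Longrightarrow> f u = f v"
  shows "f x = f y"
proof -
  have "(f x, f y) \<in> equiv_closure {}"
    using assms(1) by (rule equiv_closure_map) (simp add: assms(2))
  then show ?thesis by (simp add: equiv_closure_empty)
qed

lemma equiv_closure_class_eq_iff:
  "equiv_closure R `` {x} = equiv_closure R `` {y} \<longleftrightarrow> (x, y) \<in> equiv_closure R"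
proof
  assume "equiv_closure R `` {x} = equiv_closure R `` {y}"
  then have "y \<in> equiv_closure R `` {x}" by simp
  then show "(x, y) \<in> equiv_closure R" by simp
next
  assume "(x, y) \<in> equiv_closure R"
  then show "equiv_closure R `` {x} = equiv_closure R `` {y}"
    by (meson Image_singleton_iff equiv_closure_sym equiv_closure_trans subsetI subset_antisym)
qed

lemma equiv_closure_insert: "(x, y) \<in> equiv_closure R \<Longrightarrow> (x, y) \<in> equiv_closure (insert p R)"
  by (rule equiv_closure_mono) (auto intro: equiv_closure_base)

text \<open>
  A new edge merges the classes of its two ends and leaves all others alone.  The same count
  governs the circles of a state and the components of a dessin.
\<close>

lemma card_classes_insert:
  assumes "finite V" and "u \<in> V" and "w \<in> V"
  shows "card (V // equiv_closure R) =
           card (V // equiv_closure (insert (u, w) R)) + (if (u, w) \<in> equiv_closure R then 0 else 1)"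
proof -
  let ?R' = "insert (u, w) R"
  define f where "f x = equiv_closure R `` {x}" for x
  define g where "g x = (if f x = f w then f u else f x)" for x
  have f: "f x = f y \<longleftrightarrow> (x, y) \<in> equiv_closure R" for x y
    unfolding f_def by (rule equiv_closure_class_eq_iff)
  have g: "g x = g y" if "(x, y) \<in> equiv_closure ?R'" for x y
    using that
  proof (rule equiv_closure_invariant)
    fix p q assume "(p, q) \<in> ?R'"
    then have "(p, q) = (u, w) \<or> f p = f q"
      using equiv_closure_base[of p q R] by (auto simp: f)
    then show "g p = g q"
      by (auto simp: g_def)
  qed
  have uw: "(u, w) \<in> equiv_closure ?R'" and sub: "R \<subseteq> equiv_closure ?R'"
    by (auto intro: equiv_closure_base)
  have up: "(x, y) \<in> equiv_closure ?R'" if "f x = f y" for x y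
    using that equiv_closure_mono[OF _ sub] by (simp add: f)
  have g': "(x, y) \<in> equiv_closure ?R'" if "g x = g y" for x y
  proof -
    have xu: "(z, u) \<in> equiv_closure ?R'" if "f z = f w" for z
      using up[OF that] uw by (blast intro: equiv_closure_trans equiv_closure_sym)
    show ?thesis
    proof (cases "f x = f w"; cases "f y = f w")
      assume "f x = f w" "f y = f w"
      then show ?thesis using up by simp
    next
      assume "f x = f w" "f y \<noteq> f w"
      then show ?thesis
        using that xu up[of u y] by (auto simp: g_def intro: equiv_closure_trans)
    next
      assume "f x \<noteq> f w" "f y = f w"
      then show ?thesis
        using that xu[of y] up[of x u] by (auto simp: g_def intro: equiv_closure_trans equiv_closure_sym)
    next
      assume "f x \<noteq> f w" "f y \<noteq> f w"
      then show ?thesis using that up by (simp add: g_def)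
    qed
  qed
  have "card (V // equiv_closure ?R') = card (g ` V)"
    unfolding quotient_eq_image
    by (rule card_image_eq_if_same_kernel, unfold equiv_closure_class_eq_iff)
       (rule iffI, erule g, erule g')
  moreover have "card (f ` V) = card (g ` V) + (if f u = f w then 0 else 1)"
  proof (cases "f u = f w")
    case True
    then have "g = f" by (intro ext) (simp add: g_def)
    with True show ?thesis by simp
  next
    case False
    have "g ` V = f ` V - {f w}"
    proof (intro equalityI subsetI)
      fix K assume "K \<in> g ` V"
      then obtain x where "x \<in> V" "K = g x" by blast
      with False assms(2) show "K \<in> f ` V - {f w}" by (simp add: g_def)
    next
      fix K assume "K \<in> f ` V - {f w}"
      then obtain x where "x \<in> V" "K = f x" "f x \<noteq> f w" by blast
      then have "K = g x" by (simp add: g_def)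
      with \<open>x \<in> V\<close> show "K \<in> g ` V" by blast
    qed
    moreover have "f w \<in> f ` V" "finite (f ` V)" using assms by blast+
    ultimately have "card (f ` V) = Suc (card (g ` V))"
      by (metis card_Suc_Diff1)
    with False show ?thesis by simp
  qed
  moreover have "card (V // equiv_closure R) = card (f ` V)"
    unfolding quotient_eq_image f_def by (rule refl)
  ultimately show ?thesis
    by (simp only: f)
qed

section \<open>Orbits and first returns\<close>

lemma orbit_closed:
  assumes "\<And>z. z \<in> Y \<Longrightarrow> f z \<in> Y" and "x \<in> Y"
  shows "orbit f x \<subseteq> Y"
proof
  fix y assume "y \<in> orbit f x"
  then show "y \<in> Y" by induction (use assms in auto)
qed

lemma self_in_orbit_bij:
  assumes "finite Y" and "bij_betw f Y Y" and "x \<in> Y"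
  shows "x \<in> orbit f x"
proof -
  have "bij_betw (perm_restrict f Y) Y Y"
    using assms(2) by (rule bij_betw_cong[THEN iffD1, rotated]) (simp add: perm_restrict_def)
  then have "perm_restrict f Y permutes Y"
    by (rule bij_imp_permutes) (simp add: perm_restrict_def)
  then have "permutation (perm_restrict f Y)"
    using assms(1) by (auto simp: permutation_permutes)
  then have "x \<in> orbit (perm_restrict f Y) x"
    by (rule permutation_self_in_orbit)
  moreover have "orbit f x = orbit (perm_restrict f Y) x"
    using assms by (intro orbit_cong0[of x Y]) (auto simp: perm_restrict_def bij_betw_def)
  ultimately show ?thesis by simp
qed

lemma orbit_eq_iff_bij:
  assumes "finite Y" and "bij_betw f Y Y" and "x \<in> Y" and "y \<in> Y"
  shows "orbit f x = orbit f y \<longleftrightarrow> y \<in> orbit f x"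
proof
  assume "orbit f x = orbit f y"
  then show "y \<in> orbit f x" using self_in_orbit_bij assms by metis
next
  assume "y \<in> orbit f x"
  moreover from this have "x \<in> orbit f y"
    using self_in_orbit_bij assms orbit_swap by metis
  ultimately show "orbit f x = orbit f y"
    by (blast intro: orbit_trans)
qed

lemma orbit_cong_step:
  assumes "g x = g y"
  shows "orbit g x = orbit g y"
proof -
  have "orbit g x \<subseteq> orbit g y" if "g x = g y" for x y
  proof
    fix z assume "z \<in> orbit g x"
    then show "z \<in> orbit g y"
      by induction (use that in \<open>auto intro: orbit.intros simp: orbit.base\<close>)
  qed
  with assms show ?thesis by (metis subset_antisym)
qed

lemma orbit_unfold: "orbit f x = insert (f x) (orbit f (f x))"
proof (intro set_eqI iffI)
  fix y assume "y \<in> orbit f x"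
  then show "y \<in> insert (f x) (orbit f (f x))"
    by induction (auto intro: orbit.intros)
next
  fix y assume "y \<in> insert (f x) (orbit f (f x))"
  then show "y \<in> orbit f x"
    by (auto intro: orbit.intros orbit_subset)
qed

lemma first_return_hit: "f x \<in> S \<Longrightarrow> first_return f S x = f x"
proof -
  assume "f x \<in> S"
  then have "(LEAST n. 0 < n \<and> (f ^^ n) x \<in> S) = 1"
    by (intro Least_equality) auto
  then show ?thesis by (simp add: first_return_def)
qed

lemma first_return_miss:
  assumes "f x \<notin> S" and "orbit f (f x) \<inter> S \<noteq> {}"
  shows "first_return f S x = first_return f S (f x)"
proof -
  let ?P = "\<lambda>n. 0 < n \<and> (f ^^ n) x \<in> S"
  obtain n where n: "0 < n" "(f ^^ n) (f x) \<in> S"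
    using assms(2) by (auto simp: orbit_altdef)
  then have "?P (Suc n)" by (simp add: funpow_swap1)
  then have "(LEAST n. ?P n) = Suc (LEAST m. ?P (Suc m))"
    by (rule Least_Suc) simp
  also have "(\<lambda>m. ?P (Suc m)) = (\<lambda>m. 0 < m \<and> (f ^^ m) (f x) \<in> S)"
    using assms(1) by (auto simp: funpow_swap1 intro!: gr0I)
  finally show ?thesis
    by (simp add: first_return_def funpow_swap1)
qed

text \<open>
  A first return is either the next point or the first return from the next point.  This
  induction replaces all reasoning about minimal exponents.
\<close>

lemma first_return_induct [consumes 1, case_names hit miss]:
  assumes "orbit f x \<inter> S \<noteq> {}"
    and hit: "\<And>x. f x \<in> S \<Longrightarrow> Q x"
    and miss: "\<And>x. f x \<notin> S \<Longrightarrow> orbit f (f x) \<inter> S \<noteq> {} \<Longrightarrow> Q (f x) \<Longrightarrow> Q x"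
  shows "Q x"
proof -
  obtain n where "(f ^^ Suc n) x \<in> S"
    using assms(1) by (auto simp: orbit_altdef gr0_conv_Suc)
  then show ?thesis
  proof (induction n arbitrary: x)
    case 0
    then show ?case by (simp add: hit)
  next
    case (Suc n)
    then have *: "(f ^^ Suc n) (f x) \<in> S"
      by (simp add: funpow_swap1)
    then have "orbit f (f x) \<inter> S \<noteq> {}"
      unfolding orbit_altdef by blast
    with Suc.IH[OF *] hit miss show ?case by blast
  qed
qed

lemma first_return_in:
  assumes "orbit f x \<inter> S \<noteq> {}"
  shows "first_return f S x \<in> orbit f x \<inter> S"
  using assms
proof (induction rule: first_return_induct)
  case (hit x)
  then show ?case by (simp add: first_return_hit orbit.base)
next
  case (miss x)
  then show ?case by (auto simp: first_return_miss intro: orbit_subset)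
qed

lemma first_return_cong_step:
  assumes "g x = g y" and "orbit g x \<inter> S \<noteq> {}"
  shows "first_return g S x = first_return g S y"
proof (cases "g x \<in> S")
  case True
  with assms(1) show ?thesis by (simp add: first_return_hit)
next
  case False
  then have "orbit g (g x) \<inter> S \<noteq> {}"
    using assms(2) orbit_unfold[of g x] by auto
  with False assms(1) show ?thesis by (simp add: first_return_miss)
qed

text \<open>
  The cyclic order of a sub-dessin is a first return of the cyclic order of the whole dessin, which
  is itself a first return of the walk along a circle.  Only the walk and the smaller set matter.
\<close>

lemma first_return_first_return:
  assumes "orbit f x \<inter> T \<noteq> {}" and "T \<subseteq> S"
  shows "first_return (first_return f S) T x = first_return f T x"
proof -
  let ?g = "first_return f S"
  have "orbit ?g x \<inter> T \<noteq> {} \<and> first_return ?g T x = first_return f T x"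
    using assms(1)
  proof (induction rule: first_return_induct)
    case (hit x)
    then have "?g x = f x" using assms(2) by (auto simp: first_return_hit)
    with hit show ?case
      using orbit.base[of ?g x] by (auto simp: first_return_hit)
  next
    case (miss x)
    show ?case
    proof (cases "f x \<in> S")
      case True
      then have "?g x = f x" by (rule first_return_hit)
      with miss show ?thesis
        using orbit_unfold[of ?g x] by (auto simp: first_return_miss)
    next
      case False
      then have "?g x = ?g (f x)"
        using miss assms(2) by (intro first_return_miss) auto
      moreover from this have "orbit ?g x = orbit ?g (f x)"
        by (rule orbit_cong_step)
      ultimately show ?thesis
        using miss by (metis first_return_cong_step first_return_miss)
    qed
  qed
  then show ?thesis by blast
qed

text \<open>
  Consequently the cycles of the induced order on \<open>S\<close> correspond to the orbits of \<open>f\<close> that meet \<open>S\<close>.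
\<close>

lemma orbit_first_return:
  assumes "\<And>z. z \<in> S \<Longrightarrow> z \<in> orbit f z" and "x \<in> S"
  shows "orbit (first_return f S) x = orbit f x \<inter> S"
proof (intro set_eqI iffI)
  have step: "first_return f S z \<in> orbit f z \<inter> S" if "z \<in> S" for z
    using that assms(1) by (intro first_return_in) blast
  fix y assume "y \<in> orbit (first_return f S) x"
  then show "y \<in> orbit f x \<inter> S"
  proof induction
    case base
    show ?case using assms step by blast
  next
    case (step y)
    then show ?case
      using \<open>\<And>z. z \<in> S \<Longrightarrow> first_return f S z \<in> orbit f z \<inter> S\<close> by (blast intro: orbit_trans)
  qed
next
  fix y assume y: "y \<in> orbit f x \<inter> S"
  then obtain n where "y = (f ^^ Suc n) x"
    by (auto simp: orbit_altdef gr0_conv_Suc)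
  then show "y \<in> orbit (first_return f S) x"
  proof (induction n arbitrary: x)
    case 0
    with y show ?case using first_return_hit[of f x S] orbit.base[of "first_return f S" x] by auto
  next
    case (Suc n)
    then have eq: "y = (f ^^ Suc n) (f x)" by (simp add: funpow_swap1)
    then have IH: "y \<in> orbit (first_return f S) (f x)" by (rule Suc.IH)
    show ?case
    proof (cases "f x \<in> S")
      case True
      then have "first_return f S x = f x" by (rule first_return_hit)
      with IH show ?thesis by (metis orbit_subset)
    next
      case False
      moreover have "y \<in> orbit f (f x)" using eq unfolding orbit_altdef by blast
      ultimately have "first_return f S x = first_return f S (f x)"
        using y by (intro first_return_miss) auto
      with IH show ?thesis using orbit_cong_step by metis
    qed
  qed
qed

lemma funpow_semiconj:
  assumes "\<And>z. z \<in> A \<Longrightarrow> g z \<in> A" and "\<And>z. z \<in> A \<Longrightarrow> \<psi> (g z) = G (\<psi> z)" and "x \<in> A"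
  shows "(g ^^ n) x \<in> A \<and> \<psi> ((g ^^ n) x) = (G ^^ n) (\<psi> x)"
  using assms by (induction n) auto

lemma first_return_semiconj:
  assumes "\<And>z. z \<in> A \<Longrightarrow> g z \<in> A" and "\<And>z. z \<in> A \<Longrightarrow> \<psi> (g z) = G (\<psi> z)" and "x \<in> A"
    and "\<And>z. z \<in> A \<Longrightarrow> z \<in> S \<longleftrightarrow> \<psi> z \<in> T"
  shows "\<psi> (first_return g S x) = first_return G T (\<psi> x)"
  using funpow_semiconj[of A g \<psi> G x] assms by (simp add: first_return_def)

lemma first_return_closed:
  assumes "\<And>z. z \<in> A \<Longrightarrow> g z \<in> A" and "x \<in> A"
  shows "first_return g S x \<in> A"
  using funpow_semiconj[of A g "\<lambda>z. z" g x] assms by (simp add: first_return_def)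

lemma orbit_semiconj:
  assumes "\<And>z. z \<in> A \<Longrightarrow> g z \<in> A" and "\<And>z. z \<in> A \<Longrightarrow> \<psi> (g z) = G (\<psi> z)" and "x \<in> A"
  shows "orbit G (\<psi> x) = \<psi> ` orbit g x"
proof -
  have "(G ^^ n) (\<psi> x) = \<psi> ((g ^^ n) x)" for n
    using funpow_semiconj[of A g \<psi> G x] assms by simp
  then show ?thesis unfolding orbit_altdef by auto
qed

text \<open>
  Here \<open>\<rho>\<close> is \<open>\<tau>\<close> followed by the permutation \<open>s\<close> of \<open>S\<close>.  Its orbits that avoid \<open>S\<close> are orbits of
  \<open>\<tau>\<close>; those that meet \<open>S\<close> are cycles of its first return to \<open>S\<close>, and that return is the one of \<open>\<tau>\<close>
  followed by \<open>s\<close>.  Below, \<open>\<tau>\<close> walks along the circles of the all-A state, \<open>S\<close> contains the points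
  where the walk departs from an arc-end, and \<open>s\<close> hops to the other end of the arc: the first
  summand becomes the number of faces that follow some edge, the second the number of isolated
  vertices.
\<close>

lemma card_orbits_switched:
  assumes fin: "finite Y" and \<tau>: "bij_betw \<tau> Y Y" and SY: "S \<subseteq> Y" and s: "bij_betw s S S"
    and \<rho>: "\<And>h. h \<in> Y \<Longrightarrow> \<rho> h = (if \<tau> h \<in> S then s (\<tau> h) else \<tau> h)"
  shows "card (orbit \<rho> ` Y) = card (orbit (\<lambda>h. s (first_return \<tau> S h)) ` S)
           + card (orbit \<tau> ` {h \<in> Y. orbit \<tau> h \<inter> S = {}})"
proof -
  let ?s = "\<lambda>h. if h \<in> S then s h else h"
  have "bij_betw ?s (S \<union> (Y - S)) (S \<union> (Y - S))"
  proof (rule bij_betw_combine)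
    show "bij_betw ?s S S"
      using s by (rule bij_betw_cong[THEN iffD1, rotated]) simp
    show "bij_betw ?s (Y - S) (Y - S)"
      by (rule bij_betw_cong[THEN iffD1, rotated, OF bij_betw_id]) simp
  qed auto
  then have "bij_betw ?s Y Y" using SY by (simp add: Un_absorb1)
  from bij_betw_trans[OF \<tau> this] have bij: "bij_betw \<rho> Y Y"
    by (rule bij_betw_cong[THEN iffD1, rotated]) (simp add: \<rho>)
  have \<tau>Y: "\<tau> z \<in> Y" if "z \<in> Y" for z using \<tau> that by (auto simp: bij_betw_def)
  have \<rho>Y: "\<rho> z \<in> Y" if "z \<in> Y" for z using bij that by (auto simp: bij_betw_def)
  have sS: "s z \<in> S" if "z \<in> S" for z using s that by (auto simp: bij_betw_def)
  note self\<tau> = self_in_orbit_bij[OF fin \<tau>] and self\<rho> = self_in_orbit_bij[OF fin bij]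
  have sub\<tau>: "orbit \<tau> h \<subseteq> Y" and sub\<rho>: "orbit \<rho> h \<subseteq> Y" if "h \<in> Y" for h
    using orbit_closed[of Y] \<tau>Y \<rho>Y that by blast+
  have avoid: "orbit \<rho> h = orbit \<tau> h"
    if h: "h \<in> Y" and "orbit \<tau> h \<inter> S = {} \<or> orbit \<rho> h \<inter> S = {}" for h
    using that(2)
  proof
    assume *: "orbit \<tau> h \<inter> S = {}"
    show ?thesis
    proof (rule orbit_cong[OF self\<tau>[OF h]])
      fix z assume z: "z \<in> orbit \<tau> h"
      then have "\<tau> z \<notin> S" using * orbit.step by fastforce
      with z sub\<tau>[OF h] show "\<rho> z = \<tau> z" by (auto simp: \<rho>)
    qed
  next
    assume *: "orbit \<rho> h \<inter> S = {}"
    show ?thesis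
    proof (rule orbit_cong[OF self\<rho>[OF h], symmetric])
      fix z assume z: "z \<in> orbit \<rho> h"
      then have "\<rho> z \<notin> S" using * orbit.step by fastforce
      with z sub\<rho>[OF h] sS show "\<tau> z = \<rho> z"
        by (metis \<rho> subsetD)
    qed
  qed
  define Y1 where "Y1 = {h \<in> Y. orbit \<rho> h \<inter> S \<noteq> {}}"
  define Y0 where "Y0 = {h \<in> Y. orbit \<tau> h \<inter> S = {}}"
  have "Y = Y1 \<union> Y0" using avoid by (auto simp: Y1_def Y0_def)
  have "orbit \<rho> ` Y0 = orbit \<tau> ` Y0"
    using avoid by (auto simp: Y0_def image_iff)
  moreover have "orbit \<rho> ` Y1 = orbit \<rho> ` S"
  proof (intro equalityI subsetI)
    fix K assume "K \<in> orbit \<rho> ` Y1"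
    then obtain h z where "h \<in> Y" "K = orbit \<rho> h" "z \<in> S" "z \<in> orbit \<rho> h"
      unfolding Y1_def by blast
    moreover have "z \<in> Y" using \<open>z \<in> S\<close> SY by blast
    ultimately show "K \<in> orbit \<rho> ` S"
      using orbit_eq_iff_bij[OF fin bij] by blast
  next
    fix K assume "K \<in> orbit \<rho> ` S"
    then show "K \<in> orbit \<rho> ` Y1"
      using self\<rho> SY unfolding Y1_def by blast
  qed
  ultimately have "orbit \<rho> ` Y = orbit \<rho> ` S \<union> orbit \<tau> ` Y0"
    using \<open>Y = Y1 \<union> Y0\<close> by (simp add: image_Un)
  moreover have "orbit \<rho> ` S \<inter> orbit \<tau> ` Y0 = {}"
    using self\<rho> SY unfolding Y0_def by blast
  moreover have "finite S" "finite Y0" using fin SY finite_subset by (auto simp: Y0_def)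
  ultimately have card: "card (orbit \<rho> ` Y) = card (orbit \<rho> ` S) + card (orbit \<tau> ` Y0)"
    by (simp add: card_Un_disjoint)
  have of: "orbit (first_return \<rho> S) x = orbit \<rho> x \<inter> S" if "x \<in> S" for x
    using that self\<rho> SY by (intro orbit_first_return) auto
  have "card (orbit \<rho> ` S) = card (orbit (first_return \<rho> S) ` S)"
  proof (rule card_image_eq_if_same_kernel)
    fix x y assume xy: "x \<in> S" "y \<in> S"
    then have "orbit \<rho> x = orbit \<rho> y \<longleftrightarrow> y \<in> orbit \<rho> x"
      using orbit_eq_iff_bij[OF fin bij] SY by blast
    moreover have "y \<in> orbit \<rho> y" using xy SY self\<rho> by blast
    ultimately show "orbit \<rho> x = orbit \<rho> y \<longleftrightarrow>
        orbit (first_return \<rho> S) x = orbit (first_return \<rho> S) y"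
      using xy by (auto simp: of)
  qed
  also have "orbit (first_return \<rho> S) ` S = orbit (\<lambda>h. s (first_return \<tau> S h)) ` S"
  proof (rule image_cong[OF refl])
    have eq: "first_return \<rho> S x = s (first_return \<tau> S x)" if "x \<in> S" for x
    proof -
      have "orbit \<tau> x \<inter> S \<noteq> {}" using that SY self\<tau> by blast
      then have "x \<in> Y \<longrightarrow> orbit \<rho> x \<inter> S \<noteq> {} \<and> first_return \<rho> S x = s (first_return \<tau> S x)"
      proof (induction rule: first_return_induct)
        case (hit x)
        show ?case
        proof (intro impI)
          assume "x \<in> Y"
          then have "\<rho> x = s (\<tau> x)" using hit \<rho> by simp
          with hit sS[of "\<tau> x"] orbit.base[of \<rho> x]
          show "orbit \<rho> x \<inter> S \<noteq> {} \<and> first_return \<rho> S x = s (first_return \<tau> S x)"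
            by (auto simp: first_return_hit)
        qed
      next
        case (miss x)
        show ?case
        proof (intro impI)
          assume "x \<in> Y"
          then have "\<rho> x = \<tau> x" "\<tau> x \<in> Y" using miss \<rho> \<tau>Y by auto
          with miss show "orbit \<rho> x \<inter> S \<noteq> {} \<and> first_return \<rho> S x = s (first_return \<tau> S x)"
            using orbit_unfold[of \<rho> x] by (auto simp: first_return_miss)
        qed
      qed
      with that SY show ?thesis by blast
    qed
    fix x assume "x \<in> S"
    moreover have "first_return \<rho> S z \<in> S" if "z \<in> S" for z
    proof -
      have "orbit \<rho> z \<inter> S \<noteq> {}" using that SY self\<rho> by blast
      then show ?thesis using first_return_in by fast
    qed
    ultimately show "orbit (first_return \<rho> S) x = orbit (\<lambda>h. s (first_return \<tau> S h)) x"
      using eq by (intro orbit_cong0[of x S]) auto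
  qed
  finally show ?thesis using card by (simp add: Y0_def)
qed

section \<open>Even edge sets of planar maps\<close>

lemma even_card_fixpoint_free_involution:
  assumes "finite K" and "\<And>x. x \<in> K \<Longrightarrow> f x \<in> K \<and> f x \<noteq> x \<and> f (f x) = x"
  shows "even (card K)"
  using assms
proof (induction K rule: finite_psubset_induct)
  case (psubset K)
  show ?case
  proof (cases "K = {}")
    case False
    then obtain x where x: "x \<in> K" by blast
    let ?L = "K - {x, f x}"
    have "even (card ?L)"
    proof (rule psubset.IH)
      show "?L \<subset> K" using x by blast
      fix y assume "y \<in> ?L"
      then show "f y \<in> ?L \<and> f y \<noteq> y \<and> f (f y) = y"
        using psubset.prems x by (metis DiffE DiffI empty_iff insert_iff)
    qed
    moreover have "card K = card ?L + card {x, f x}"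
      using psubset.prems[OF x] x psubset.hyps
      by (subst card_Un_disjoint[symmetric]) (auto intro: arg_cong[where f = card])
    moreover have "card {x, f x} = 2"
      using psubset.prems[OF x] by (metis card_2_iff)
    ultimately show ?thesis by simp
  qed simp
qed

abbreviation symm_diff :: "'a set \<Rightarrow> 'a set \<Rightarrow> 'a set" (infixl "\<ominus>" 65) where
  "A \<ominus> B \<equiv> (A - B) \<union> (B - A)"

lemma symm_diff_cancel: "A \<ominus> (A \<ominus> B) = B"
  by blast

lemma even_card_symm_diff:
  assumes "finite A" and "finite B"
  shows "even (card (A \<ominus> B)) \<longleftrightarrow> (even (card A) \<longleftrightarrow> even (card B))"
proof -
  have "card (A \<ominus> B) = card (A - B) + card (B - A)"
    using assms by (intro card_Un_disjoint) auto
  moreover have "card A = card (A - B) + card (A \<inter> B)" "card B = card (B - A) + card (A \<inter> B)"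
    using assms by (metis card_Diff_subset_Int card_Int_Diff add.commute inf_commute)+
  ultimately show ?thesis by auto
qed

text \<open>
  Families of sets that are closed under symmetric difference are vector spaces over the field with
  two elements; this is the rank formula for a linear map, stated for cardinalities.
\<close>

lemma card_eq_image_times_kernel:
  fixes f :: "'a set \<Rightarrow> 'b set"
  assumes fin: "finite A" and closed: "\<And>S T. S \<in> A \<Longrightarrow> T \<in> A \<Longrightarrow> S \<ominus> T \<in> A"
    and hom: "\<And>S T. S \<in> A \<Longrightarrow> T \<in> A \<Longrightarrow> f (S \<ominus> T) = f S \<ominus> f T"
  shows "card A = card (f ` A) * card {S \<in> A. f S = {}}"
proof -
  have fibre: "card {S \<in> A. f S = y} = card {S \<in> A. f S = {}}" if y: "y \<in> f ` A" for y
  proof -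
    obtain S0 where S0: "S0 \<in> A" "f S0 = y" using y by blast
    have "bij_betw (\<lambda>S. S0 \<ominus> S) {S \<in> A. f S = y} {S \<in> A. f S = {}}"
    proof (rule bij_betw_byWitness[where f' = "\<lambda>S. S0 \<ominus> S"])
      show "(\<lambda>S. S0 \<ominus> S) ` {S \<in> A. f S = y} \<subseteq> {S \<in> A. f S = {}}"
        using S0 closed by (auto simp: hom)
      show "(\<lambda>S. S0 \<ominus> S) ` {S \<in> A. f S = {}} \<subseteq> {S \<in> A. f S = y}"
        using S0 closed by (auto simp: hom)
    qed (auto simp: symm_diff_cancel)
    then show ?thesis by (rule bij_betw_same_card)
  qed
  have "card A = (\<Sum>y\<in>f ` A. card {S \<in> A. f S = y})"
    using sum.image_gen[OF fin, of "\<lambda>_. 1" f] by (simp only: card_eq_sum)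
  then show ?thesis by (simp add: fibre)
qed

text \<open>
  An invariant subset is a union of orbits, and any union of orbits is invariant.
\<close>

lemma card_invariant_subsets:
  assumes fin: "finite X" and bij: "bij_betw f X X"
  shows "card {S. S \<subseteq> X \<and> (\<forall>h\<in>X. f h \<in> S \<longleftrightarrow> h \<in> S)} = 2 ^ card (orbit f ` X)"
proof -
  let ?I = "{S. S \<subseteq> X \<and> (\<forall>h\<in>X. f h \<in> S \<longleftrightarrow> h \<in> S)}"
  note self = self_in_orbit_bij[OF fin bij]
  have sub: "orbit f x \<subseteq> X" if "x \<in> X" for x
    using orbit_closed[of X f x] that bij by (auto simp: bij_betw_def)
  have eq: "orbit f y = orbit f x" if "x \<in> X" "y \<in> orbit f x" for x y
    using orbit_eq_iff_bij[OF fin bij that(1)] that sub by blast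
  have "bij_betw Union (Pow (orbit f ` X)) ?I"
  proof (rule bij_betw_byWitness[where f' = "\<lambda>S. orbit f ` S"])
    show "\<forall>\<O>\<in>Pow (orbit f ` X). orbit f ` \<Union>\<O> = \<O>"
    proof (intro ballI equalityI subsetI)
      fix \<O> K assume \<O>: "\<O> \<in> Pow (orbit f ` X)" and "K \<in> orbit f ` \<Union>\<O>"
      then obtain L x where "L \<in> \<O>" "x \<in> L" "K = orbit f x" by blast
      moreover from this \<O> obtain z where "z \<in> X" "L = orbit f z" by blast
      ultimately show "K \<in> \<O>" using eq by simp
    next
      fix \<O> K assume \<O>: "\<O> \<in> Pow (orbit f ` X)" and K: "K \<in> \<O>"
      then obtain z where "z \<in> X" "K = orbit f z" by blast
      with self K show "K \<in> orbit f ` \<Union>\<O>" by blast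
    qed
    show "\<forall>S\<in>?I. \<Union>(orbit f ` S) = S"
    proof (intro ballI equalityI subsetI)
      fix S y assume S: "S \<in> ?I" and "y \<in> \<Union>(orbit f ` S)"
      then obtain x where "x \<in> S" "y \<in> orbit f x" by blast
      moreover have "orbit f x \<subseteq> S" using orbit_closed[of S f x] S \<open>x \<in> S\<close> by blast
      ultimately show "y \<in> S" by blast
    next
      fix S y assume "S \<in> ?I" "y \<in> S"
      then show "y \<in> \<Union>(orbit f ` S)" using self by blast
    qed
    show "Union ` Pow (orbit f ` X) \<subseteq> ?I"
    proof
      fix S assume "S \<in> Union ` Pow (orbit f ` X)"
      then obtain \<O> where \<O>: "\<O> \<subseteq> orbit f ` X" "S = \<Union>\<O>" by blast
      have "f h \<in> S \<longleftrightarrow> h \<in> S" if h: "h \<in> X" for h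
      proof -
        have *: "g \<in> S \<longleftrightarrow> orbit f g \<in> \<O>" if g: "g \<in> X" for g
        proof
          assume "g \<in> S"
          then obtain z where "z \<in> X" "orbit f z \<in> \<O>" "g \<in> orbit f z" using \<O> by blast
          then show "orbit f g \<in> \<O>" using eq by metis
        qed (use self[OF g] \<O> in blast)
        moreover have "f h \<in> X" using h bij by (auto simp: bij_betw_def)
        moreover have "orbit f (f h) = orbit f h"
          using h orbit.base by (rule eq)
        ultimately show ?thesis using h by simp
      qed
      moreover have "S \<subseteq> X"
      proof
        fix y assume "y \<in> S"
        then obtain z where "z \<in> X" "y \<in> orbit f z" using \<O> by blast
        then show "y \<in> X" using sub by blast
      qed
      ultimately show "S \<in> ?I" by simp
    qed
    show "(\<lambda>S. orbit f ` S) ` ?I \<subseteq> Pow (orbit f ` X)" by blast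
  qed
  from bij_betw_same_card[OF this, symmetric]
  have "card ?I = card (Pow (orbit f ` X))" .
  then show ?thesis using fin by (simp add: card_Pow)
qed

text \<open>
  A surface of genus 0 has no homology in degree 1 over the field with two elements.  The
  half-edges are \<open>X\<close>; edges are orbits of \<open>op\<close>, faces are orbits of \<open>\<phi>\<close>, and \<open>blk\<close> maps a half-edge to
  its vertex.  Sets of edges and of faces are represented by invariant sets of half-edges; \<open>bd\<close>
  sends a set of edges to the vertices of odd degree and \<open>\<delta>\<close> sends a set of faces to the edges with
  exactly one side in it.

  Let there be $V$ vertices, $E$ edges and $F$ faces.  By connectedness the image of \<open>bd\<close> has at least
  $2^{V-1}$ elements, so at most $2^{E-V+1}$ edge sets are even.  Again by connectedness only the
  empty set and the set of all faces are in the kernel of \<open>\<delta>\<close>, so there are at least $2^{F-1}$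
  boundaries.  Boundaries are even, and Euler's formula says that the two exponents are equal.
\<close>

lemma planar_even_set_is_boundary:
  fixes X :: "'h set" and blk :: "'h \<Rightarrow> 'b"
  assumes fin: "finite X" and \<phi>: "bij_betw \<phi> X X"
    and op: "\<And>h. h \<in> X \<Longrightarrow> op h \<in> X \<and> op h \<noteq> h \<and> op (op h) = h"
    and blk: "\<And>h. h \<in> X \<Longrightarrow> blk (\<phi> (op h)) = blk h"
    and conn: "\<And>S. S \<subseteq> X \<Longrightarrow> (\<And>h. h \<in> X \<Longrightarrow> \<phi> h \<in> S \<longleftrightarrow> h \<in> S) \<Longrightarrow>
                 (\<And>h. h \<in> X \<Longrightarrow> op h \<in> S \<longleftrightarrow> h \<in> S) \<Longrightarrow> S = {} \<or> S = X"
    and euler: "card (blk ` X) + card (orbit \<phi> ` X) = card (orbit op ` X) + 2"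
    and C: "C \<subseteq> X" "\<And>h. h \<in> X \<Longrightarrow> op h \<in> C \<longleftrightarrow> h \<in> C"
    and even_C: "\<And>h. h \<in> X \<Longrightarrow> even (card {g \<in> C. blk g = blk h})"
  obtains S where "\<And>h. h \<in> X \<Longrightarrow> \<phi> h \<in> S \<longleftrightarrow> h \<in> S"
    and "\<And>h. h \<in> X \<Longrightarrow> op h \<in> S \<longleftrightarrow> (h \<in> S) \<noteq> (h \<in> C)"
proof -
  define \<E> where "\<E> = {S. S \<subseteq> X \<and> (\<forall>h\<in>X. op h \<in> S \<longleftrightarrow> h \<in> S)}"
  define \<F> where "\<F> = {S. S \<subseteq> X \<and> (\<forall>h\<in>X. \<phi> h \<in> S \<longleftrightarrow> h \<in> S)}"
  define bd where "bd S = {v \<in> blk ` X. odd (card {g \<in> S. blk g = v})}" for S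
  define \<delta> where "\<delta> S = {h \<in> X. op h \<in> S \<longleftrightarrow> h \<notin> S}" for S
  have "bij_betw op X X"
    by (rule bij_betw_byWitness[where f' = op]) (use op in auto)
  then have card_\<E>: "card \<E> = 2 ^ card (orbit op ` X)"
    unfolding \<E>_def using fin by (intro card_invariant_subsets)
  have card_\<F>: "card \<F> = 2 ^ card (orbit \<phi> ` X)"
    unfolding \<F>_def using fin \<phi> by (intro card_invariant_subsets)
  have fin\<E>: "finite \<E>" and fin\<F>: "finite \<F>"
    using fin by (auto simp: \<E>_def \<F>_def)
  have \<phi>X: "\<phi> h \<in> X" if "h \<in> X" for h using \<phi> that by (auto simp: bij_betw_def)

  have closed\<E>: "S \<ominus> T \<in> \<E>" if "S \<in> \<E>" "T \<in> \<E>" for S T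
    using that unfolding \<E>_def by blast
  have hom_bd: "bd (S \<ominus> T) = bd S \<ominus> bd T" if "S \<in> \<E>" "T \<in> \<E>" for S T
  proof -
    have "even (card {g \<in> S \<ominus> T. blk g = v}) \<longleftrightarrow>
        (even (card {g \<in> S. blk g = v}) \<longleftrightarrow> even (card {g \<in> T. blk g = v}))" for v
    proof -
      have "{g \<in> S \<ominus> T. blk g = v} = {g \<in> S. blk g = v} \<ominus> {g \<in> T. blk g = v}" by blast
      moreover have "finite S" "finite T"
        using that fin finite_subset by (auto simp: \<E>_def)
      ultimately show ?thesis by (simp add: even_card_symm_diff)
    qed
    then show ?thesis unfolding bd_def by blast
  qed
  have ker_bd: "card \<E> = card (bd ` \<E>) * card {S \<in> \<E>. bd S = {}}"
    using fin\<E> closed\<E> hom_bd by (rule card_eq_image_times_kernel)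

  have closed\<F>: "S \<ominus> T \<in> \<F>" if "S \<in> \<F>" "T \<in> \<F>" for S T
    using that unfolding \<F>_def by blast
  have hom_\<delta>: "\<delta> (S \<ominus> T) = \<delta> S \<ominus> \<delta> T" for S T
    unfolding \<delta>_def by blast
  have ker_\<delta>: "card \<F> = card (\<delta> ` \<F>) * card {S \<in> \<F>. \<delta> S = {}}"
    using fin\<F> closed\<F> hom_\<delta> by (rule card_eq_image_times_kernel)

  \<comment> \<open>A set of faces without boundary edges is closed under crossing edges.\<close>
  have "{S \<in> \<F>. \<delta> S = {}} \<subseteq> {{}, X}"
  proof
    fix S assume "S \<in> {S \<in> \<F>. \<delta> S = {}}"
    then have "S = {} \<or> S = X"
      by (intro conn) (auto simp: \<F>_def \<delta>_def)
    then show "S \<in> {{}, X}" by blast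
  qed
  then have "card {S \<in> \<F>. \<delta> S = {}} \<le> card {{}, X}"
    by (intro card_mono) auto
  also have "\<dots> \<le> 2" by (simp add: card_insert_if)
  finally have "card (\<delta> ` \<F>) * card {S \<in> \<F>. \<delta> S = {}} \<le> card (\<delta> ` \<F>) * 2"
    by (rule mult_le_mono2)
  then have \<F>_le: "2 ^ card (orbit \<phi> ` X) \<le> card (\<delta> ` \<F>) * 2"
    unfolding ker_\<delta>[symmetric] card_\<F> .

  have "X \<noteq> {}" using euler by auto
  then obtain h0 where h0: "h0 \<in> X" by blast
  have closed_im: "U \<ominus> W \<in> bd ` \<E>" if UW: "U \<in> bd ` \<E>" "W \<in> bd ` \<E>" for U W
  proof -
    obtain S T where "S \<in> \<E>" "U = bd S" "T \<in> \<E>" "W = bd T" using UW by blast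
    then have "U \<ominus> W = bd (S \<ominus> T)" "S \<ominus> T \<in> \<E>" by (simp_all add: closed\<E> hom_bd)
    then show ?thesis by (rule image_eqI)
  qed
  \<comment> \<open>The two ends of an edge form a boundary; adding up the edges of a path, so do the vertices
    of any two half-edges.\<close>
  have edge: "{blk h} \<ominus> {blk (op h)} \<in> bd ` \<E>" if h: "h \<in> X" for h
  proof (rule image_eqI)
    have "op g \<in> {h, op h} \<longleftrightarrow> g \<in> {h, op h}" if "g \<in> X" for g
      using op[OF that] op[OF h] by (metis empty_iff insert_iff)
    moreover have "{h, op h} \<subseteq> X" using op[OF h] h by simp
    ultimately show "{h, op h} \<in> \<E>" unfolding \<E>_def by simp
    have "card {g \<in> {h, op h}. blk g = v} =
        (if blk h = v then 1 else 0) + (if blk (op h) = v then 1 else 0)" for v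
    proof -
      have "{g \<in> {h, op h}. blk g = v} =
          (if blk h = v then {h} else {}) \<union> (if blk (op h) = v then {op h} else {})"
        by auto
      then show ?thesis using op[OF h] by auto
    qed
    then have "bd {h, op h} = {v \<in> blk ` X. (blk h = v) \<noteq> (blk (op h) = v)}"
      unfolding bd_def by auto
    moreover have "blk h \<in> blk ` X" "blk (op h) \<in> blk ` X" using op[OF h] h by simp_all
    ultimately have "v \<in> bd {h, op h} \<longleftrightarrow> (v = blk h) \<noteq> (v = blk (op h))" for v
      by (cases "v = blk h"; cases "v = blk (op h)") simp_all
    then show "{blk h} \<ominus> {blk (op h)} = bd {h, op h}" by blast
  qed
  have "{h \<in> X. {blk h0} \<ominus> {blk h} \<in> bd ` \<E>} = {} \<or> {h \<in> X. {blk h0} \<ominus> {blk h} \<in> bd ` \<E>} = X"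
    (is "?Q = {} \<or> ?Q = X")
  proof (rule conn)
    have one: "op h \<in> ?Q" if "h \<in> ?Q" for h
    proof -
      have "{blk h0} \<ominus> {blk (op h)} = ({blk h0} \<ominus> {blk h}) \<ominus> ({blk h} \<ominus> {blk (op h)})" by blast
      moreover have "op h \<in> X" using that op by blast
      ultimately show ?thesis using that edge closed_im by fastforce
    qed
    show opQ: "op h \<in> ?Q \<longleftrightarrow> h \<in> ?Q" if "h \<in> X" for h
    proof
      assume "op h \<in> ?Q"
      from one[OF this] show "h \<in> ?Q" using op[OF that] by simp
    qed (rule one)
    show "\<phi> h \<in> ?Q \<longleftrightarrow> h \<in> ?Q" if "h \<in> X" for h
    proof -
      have "blk (\<phi> h) = blk (op h)" using blk[of "op h"] op[OF that] by simp
      then have "\<phi> h \<in> ?Q \<longleftrightarrow> op h \<in> ?Q" using that op \<phi>X by simp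
      with opQ[OF that] show ?thesis by blast
    qed
  qed blast
  moreover have "h0 \<in> ?Q"
    using closed_im[OF edge[OF h0] edge[OF h0]] h0 by auto
  ultimately have Q: "{blk h0} \<ominus> {blk h} \<in> bd ` \<E>" if "h \<in> X" for h
    using that by blast
  \<comment> \<open>Hence the boundaries make up at least half of all sets of vertices.\<close>
  have half: "W \<in> bd ` \<E> \<or> W \<ominus> {blk h0} \<in> bd ` \<E>" if "W \<subseteq> blk ` X" for W
  proof -
    have "finite W" using that fin finite_subset by blast
    then show ?thesis using that
    proof induction
      case empty
      have "{} \<in> bd ` \<E>" using closed_im[OF edge[OF h0] edge[OF h0]] by simp
      then show ?case by blast
    next
      case (insert v W)
      then obtain h where h: "h \<in> X" "v = blk h" by blast
      have eq: "insert v W = W \<ominus> {v}" using insert by blast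
      from insert have "W \<in> bd ` \<E> \<or> W \<ominus> {blk h0} \<in> bd ` \<E>" by blast
      then show ?case
      proof
        assume "W \<in> bd ` \<E>"
        from closed_im[OF this Q[OF h(1)]] have "W \<ominus> ({blk h0} \<ominus> {v}) \<in> bd ` \<E>" unfolding h(2) .
        moreover have "W \<ominus> ({blk h0} \<ominus> {v}) = insert v W \<ominus> {blk h0}"
          unfolding eq by blast
        ultimately show ?thesis by simp
      next
        assume "W \<ominus> {blk h0} \<in> bd ` \<E>"
        from closed_im[OF this Q[OF h(1)]]
        have "(W \<ominus> {blk h0}) \<ominus> ({blk h0} \<ominus> {v}) \<in> bd ` \<E>" unfolding h(2) .
        moreover have "(W \<ominus> {blk h0}) \<ominus> ({blk h0} \<ominus> {v}) = insert v W"
          unfolding eq by blast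
        ultimately show ?thesis by simp
      qed
    qed
  qed
  have "Pow (blk ` X) \<subseteq> bd ` \<E> \<union> (\<lambda>W. W \<ominus> {blk h0}) ` bd ` \<E>"
  proof
    fix W assume "W \<in> Pow (blk ` X)"
    then have "W \<in> bd ` \<E> \<or> W \<ominus> {blk h0} \<in> bd ` \<E>" by (intro half) blast
    then show "W \<in> bd ` \<E> \<union> (\<lambda>W. W \<ominus> {blk h0}) ` bd ` \<E>"
    proof
      assume "W \<ominus> {blk h0} \<in> bd ` \<E>"
      moreover have "W = (W \<ominus> {blk h0}) \<ominus> {blk h0}" by blast
      ultimately show ?thesis by (intro UnI2 image_eqI[where x = "W \<ominus> {blk h0}"])
    qed simp
  qed
  then have "card (Pow (blk ` X)) \<le> card (bd ` \<E> \<union> (\<lambda>W. W \<ominus> {blk h0}) ` bd ` \<E>)"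
    using fin\<E> by (intro card_mono) auto
  also have "\<dots> \<le> card (bd ` \<E>) + card ((\<lambda>W. W \<ominus> {blk h0}) ` bd ` \<E>)"
    by (rule card_Un_le)
  also have "\<dots> \<le> card (bd ` \<E>) + card (bd ` \<E>)"
    using fin\<E> by (intro add_left_mono card_image_le) simp
  finally have V_le: "2 ^ card (blk ` X) \<le> 2 * card (bd ` \<E>)"
    using fin by (simp add: card_Pow)

  \<comment> \<open>A closed turn around a vertex enters and leaves a set of faces equally often: the rotation
    maps the half-edges with the set on their left to those with the set on their right.\<close>
  have sub: "\<delta> ` \<F> \<subseteq> {S \<in> \<E>. bd S = {}}"
  proof
    fix T assume "T \<in> \<delta> ` \<F>"
    then obtain S where S: "S \<in> \<F>" and T: "T = \<delta> S" by blast
    have "T \<in> \<E>" using op unfolding T \<E>_def \<delta>_def by auto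
    moreover have "even (card {g \<in> T. blk g = v})" for v
    proof -
      let ?A = "{g \<in> X. blk g = v}"
      have inj: "inj_on (\<lambda>h. \<phi> (op h)) X"
        using \<phi> op by (auto simp: inj_on_def bij_betw_def) metis
      have "(\<lambda>h. \<phi> (op h)) ` ?A = ?A"
      proof (rule endo_inj_surj)
        show "finite ?A" using fin by simp
        show "(\<lambda>h. \<phi> (op h)) ` ?A \<subseteq> ?A" using blk op \<phi>X by auto
        show "inj_on (\<lambda>h. \<phi> (op h)) ?A" using inj by (rule inj_on_subset) blast
      qed
      moreover have "\<phi> (op g) \<in> S \<longleftrightarrow> op g \<in> S" if "g \<in> X" for g
        using S op[OF that] unfolding \<F>_def by blast
      ultimately have "{g \<in> ?A. g \<in> S} = (\<lambda>h. \<phi> (op h)) ` {g \<in> ?A. op g \<in> S}"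
        by (smt (verit) Collect_cong image_iff mem_Collect_eq image_def)
      also have "card \<dots> = card {g \<in> ?A. op g \<in> S}"
        using inj by (intro card_image) (rule inj_on_subset, auto)
      finally have "card {g \<in> ?A. g \<in> S} = card {g \<in> ?A. op g \<in> S}" .
      moreover have "{g \<in> T. blk g = v} = {g \<in> ?A. g \<in> S} \<ominus> {g \<in> ?A. op g \<in> S}"
        unfolding T \<delta>_def by blast
      ultimately show ?thesis
        using fin by (simp add: even_card_symm_diff)
    qed
    ultimately show "T \<in> {S \<in> \<E>. bd S = {}}" unfolding bd_def by simp
  qed
  have "card {S \<in> \<E>. bd S = {}} \<le> card (\<delta> ` \<F>)"
  proof -
    let ?z = "card {S \<in> \<E>. bd S = {}}" and ?i = "card (bd ` \<E>)" and ?b = "card (\<delta> ` \<F>)"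
    have "4 * (?i * ?z) = 2 ^ (card (orbit op ` X) + 2)"
      using ker_bd card_\<E> by simp
    also have "\<dots> = 2 ^ card (blk ` X) * 2 ^ card (orbit \<phi> ` X)"
      unfolding euler[symmetric] by (rule power_add)
    also have "\<dots> \<le> (2 * ?i) * (?b * 2)"
      using V_le \<F>_le by (rule mult_le_mono)
    finally have "?i * ?z \<le> ?i * ?b" by simp
    moreover have "0 < ?i" using ker_bd card_\<E> by (cases "?i = 0") auto
    ultimately show ?thesis by simp
  qed
  then have "\<delta> ` \<F> = {S \<in> \<E>. bd S = {}}"
    using fin\<E> sub by (intro card_seteq) auto
  moreover have "C \<in> {S \<in> \<E>. bd S = {}}"
    using C even_C by (auto simp: \<E>_def bd_def)
  ultimately obtain S where "S \<in> \<F>" "C = \<delta> S" by blast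
  then show thesis
    by (intro that[of S]) (auto simp: \<F>_def \<delta>_def)
qed

section \<open>Partners in a state\<close>

lemma mset_join_halves: "mset (join_halves js) = mset (map fst js) + mset (map snd js)"
  by (induction js) (auto simp: join_halves_def)

lemma set_join_halves: "set (join_halves js) = fst ` set js \<union> snd ` set js"
  by (induction js) (auto simp: join_halves_def)

lemma join_halves_append: "join_halves (js @ js') = join_halves js @ join_halves js'"
  by (simp add: join_halves_def)

lemma join_halves_Cons: "join_halves ((a, b) # js) = a # b # join_halves js"
  by (simp add: join_halves_def)

lemma joined_halves_differ:
  "distinct (join_halves js) \<Longrightarrow> (x, y) \<in> set js \<Longrightarrow> x \<noteq> y"
  by (induction js) (auto simp: join_halves_def)

lemma partner_of_join:
  assumes "distinct (join_halves js)" and "(x, y) \<in> set js"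
  shows "partner js x = y" and "partner js y = x"
proof -
  have "mset (map fst (js @ map prod.swap js)) = mset (join_halves js)"
    by (simp add: mset_join_halves comp_def)
  then have "distinct (map fst (js @ map prod.swap js))"
    using assms(1) mset_eq_imp_distinct_iff by blast
  moreover have "(x, y) \<in> set (js @ map prod.swap js)" "(y, x) \<in> set (js @ map prod.swap js)"
    using assms(2) by force+
  ultimately show "partner js x = y" "partner js y = x"
    unfolding partner_def by (metis map_of_is_SomeI option.sel)+
qed

lemma partner_props:
  assumes "distinct (join_halves js)" and "h \<in> set (join_halves js)"
  shows "partner js h \<in> set (join_halves js)" and "partner js h \<noteq> h"
    and "partner js (partner js h) = h"
    and "(h, partner js h) \<in> set js \<or> (partner js h, h) \<in> set js"
proof -
  obtain x y where xy: "(x, y) \<in> set js" "h = x \<or> h = y"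
    using assms(2) by (auto simp: set_join_halves)
  note p = partner_of_join[OF assms(1) xy(1)] and ne = joined_halves_differ[OF assms(1) xy(1)]
  have "x \<in> set (join_halves js)" "y \<in> set (join_halves js)"
    using xy(1) by (force simp: set_join_halves)+
  then show "partner js h \<in> set (join_halves js)" "partner js h \<noteq> h"
    "partner js (partner js h) = h" "(h, partner js h) \<in> set js \<or> (partner js h, h) \<in> set js"
    using xy p ne by auto
qed

lemma circle_rel_cases:
  assumes "(x, y) \<in> circle_rel op js"
    and "\<And>u v. (u, v) \<in> set js \<Longrightarrow> f u = f v"
    and "\<And>h. h \<in> set (join_halves js) \<Longrightarrow> f (op h) = f h"
  shows "f x = f y"
  using assms(1) unfolding circle_rel_def
  by (rule equiv_closure_invariant) (use assms(2,3) in auto)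

definition state_joins :: "'h diagram \<Rightarrow> 'h crossing set \<Rightarrow> ('h \<times> 'h) list" where
  "state_joins P F =
     concat (map (\<lambda>x. if x \<in> F then B_splice x else A_splice x) (crossings P)) @ joins P"

lemma all_A_joins_eq: "all_A_joins P = state_joins P {}"
  by (simp add: all_A_joins_def state_joins_def)

text \<open>
  Both splicings of a crossing use each of its half-edges once.  Hence in every state \<open>partner\<close> is an
  involution without fixed points on the half-edges of the diagram.
\<close>

lemma mset_join_halves_state_joins: "mset (join_halves (state_joins P F)) = mset (half_list P)"
proof -
  have "mset (join_halves (concat (map (\<lambda>x. if x \<in> F then B_splice x else A_splice x) xs))) =
      mset (concat (map crossing_halves xs))" for xs
  proof (induction xs)
    case (Cons x xs)
    obtain a b c d where "x = (a, b, c, d)" by (cases x)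
    with Cons show ?case
      by (simp add: join_halves_append join_halves_Cons) (simp add: join_halves_def)
  qed (simp add: join_halves_def)
  then show ?thesis
    by (simp add: state_joins_def half_list_def join_halves_append)
qed

lemma same_block_if_distinct_concat:
  assumes "distinct (concat ls)" and "l \<in> set ls" and "l' \<in> set ls" and "z \<in> set l" and "z \<in> set l'"
  shows "l = l'"
  using assms by (induction ls) auto

lemma distinct_if_distinct_concat:
  "distinct (concat ls) \<Longrightarrow> [] \<notin> set ls \<Longrightarrow> distinct ls"
proof (induction ls)
  case (Cons l ls)
  then obtain z where "z \<in> set l" by (metis list.set_intros(1) list.exhaust)
  with Cons show ?case by auto
qed simp

lemma map_fst_crossing_rotation: "map fst (crossing_rotation x) = crossing_halves x"
  by (cases x) simp

section \<open>Plane diagrams and their circles\<close>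

locale plane_diagram =
  fixes P :: "'h diagram"
  assumes projection: "connected_projection P"
begin

abbreviation "X \<equiv> halves P"
abbreviation "op \<equiv> opp P"
abbreviation "A_partner \<equiv> partner (all_A_joins P)"

lemma finite_X: "finite X"
  by (simp add: halves_def)

lemma distinct_halves: "distinct (half_list P)"
  using projection by (simp add: connected_projection_def wf_diagram_def)

lemma outer_in_X: "outer P \<in> X"
  using projection by (simp add: connected_projection_def wf_diagram_def)

lemma op_props: "h \<in> X \<Longrightarrow> op h \<in> X \<and> op h \<noteq> h \<and> op (op h) = h"
  using projection by (simp add: connected_projection_def wf_diagram_def)

lemma bij_op: "bij_betw op X X"
  by (rule bij_betw_byWitness[where f' = op]) (use op_props in auto)

lemma set_state_joins: "set (join_halves (state_joins P F)) = X"
  by (metis mset_join_halves_state_joins halves_def mset_eq_setD)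

lemma distinct_state_joins: "distinct (join_halves (state_joins P F))"
  using mset_join_halves_state_joins distinct_halves mset_eq_imp_distinct_iff by blast

lemmas state_partner =
  partner_props[OF distinct_state_joins, unfolded set_state_joins]
lemmas A_partner_props = state_partner[of _ "{}", folded all_A_joins_eq]

subsection \<open>Vertices\<close>

definition vertex_lists :: "'h list list" where
  "vertex_lists = map crossing_halves (crossings P) @ map (\<lambda>(a, b). [a, b]) (joins P)"

lemma concat_vertex_lists: "concat vertex_lists = half_list P"
  by (simp add: vertex_lists_def half_list_def join_halves_def)

lemma vertex_list_cases:
  assumes "l \<in> set vertex_lists"
  obtains a b c d where "(a, b, c, d) \<in> set (crossings P)" "l = [a, b, c, d]"
  | a b where "(a, b) \<in> set (joins P)" "l = [a, b]"
  using assms by (auto simp: vertex_lists_def)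

lemma crossing_vertex_list: "(a, b, c, d) \<in> set (crossings P) \<Longrightarrow> [a, b, c, d] \<in> set vertex_lists"
  by (force simp: vertex_lists_def)

lemma join_vertex_list: "(a, b) \<in> set (joins P) \<Longrightarrow> [a, b] \<in> set vertex_lists"
  by (force simp: vertex_lists_def)

lemma X_eq: "X = \<Union> (set ` set vertex_lists)"
  by (simp add: halves_def flip: concat_vertex_lists)

lemma vertex_list_unique:
  "l \<in> set vertex_lists \<Longrightarrow> l' \<in> set vertex_lists \<Longrightarrow> z \<in> set l \<Longrightarrow> z \<in> set l' \<Longrightarrow> l = l'"
  using same_block_if_distinct_concat distinct_halves concat_vertex_lists by metis

lemma crossing_distinct:
  assumes "(a, b, c, d) \<in> set (crossings P)"
  shows "distinct [a, b, c, d]" and "a \<in> X" and "b \<in> X" and "c \<in> X" and "d \<in> X"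
proof -
  have "[a, b, c, d] \<in> set vertex_lists" using assms by (rule crossing_vertex_list)
  then show "distinct [a, b, c, d]" "a \<in> X" "b \<in> X" "c \<in> X" "d \<in> X"
    using distinct_halves unfolding X_eq concat_vertex_lists[symmetric]
    by (force simp: distinct_concat_iff)+
qed

lemma crossing_unique:
  assumes "x \<in> set (crossings P)" and "y \<in> set (crossings P)"
    and "z \<in> set (crossing_halves x)" and "z \<in> set (crossing_halves y)"
  shows "x = y"
proof -
  have "crossing_halves x = crossing_halves y"
    using assms by (intro vertex_list_unique[of _ _ z]) (auto simp: vertex_lists_def)
  then show ?thesis by (cases x; cases y) simp
qed

lemma distinct_crossings: "distinct (crossings P)"
proof -
  have "distinct (concat (map crossing_halves (crossings P)))"
    using distinct_halves by (simp add: half_list_def)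
  moreover have "[] \<notin> set (map crossing_halves (crossings P))"
    by auto
  ultimately have "distinct (map crossing_halves (crossings P))"
    by (rule distinct_if_distinct_concat)
  then show ?thesis by (simp add: distinct_map)
qed

lemma ccw_crossing:
  assumes x: "(a, b, c, d) \<in> set (crossings P)"
  shows "ccw P a = b" and "ccw P b = c" and "ccw P c = d" and "ccw P d = a"
proof -
  let ?r = "concat (map crossing_rotation (crossings P))"
  have "map fst ?r = concat (map crossing_halves (crossings P))"
    by (simp add: map_concat comp_def map_fst_crossing_rotation)
  then have dist: "distinct (map fst ?r)"
    using distinct_halves by (simp add: half_list_def)
  have *: "ccw P g = h" if "(g, h) \<in> set (crossing_rotation (a, b, c, d))" for g h
  proof -
    have "(g, h) \<in> set ?r" using that by (auto intro!: bexI[OF _ x])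
    then have "map_of ?r g = Some h" using dist by simp
    moreover have "g \<notin> set (join_halves (joins P))"
    proof -
      have "g \<in> set (concat (map crossing_halves (crossings P)))" using x that by force
      then show ?thesis using distinct_halves by (auto simp: half_list_def)
    qed
    ultimately show ?thesis by (simp add: ccw_def)
  qed
  show "ccw P a = b" "ccw P b = c" "ccw P c = d" "ccw P d = a"
    by (rule *, simp)+
qed

lemma ccw_join:
  assumes "(a, b) \<in> set (joins P)"
  shows "ccw P a = b" and "ccw P b = a"
proof -
  have "distinct (join_halves (joins P))"
    using distinct_halves by (simp add: half_list_def)
  note p = partner_of_join[OF this assms]
  have "a \<in> set (join_halves (joins P))" "b \<in> set (join_halves (joins P))"
    using assms by (force simp: set_join_halves)+
  then show "ccw P a = b" "ccw P b = a" using p by (simp_all add: ccw_def)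
qed

lemma A_partner_crossing:
  assumes "(a, b, c, d) \<in> set (crossings P)"
  shows "A_partner a = b" and "A_partner b = a" and "A_partner c = d" and "A_partner d = c"
proof -
  have "(a, b) \<in> set (all_A_joins P)" "(c, d) \<in> set (all_A_joins P)"
    using assms by (force simp: all_A_joins_def)+
  then show "A_partner a = b" "A_partner b = a" "A_partner c = d" "A_partner d = c"
    using partner_of_join[OF distinct_state_joins[of "{}", folded all_A_joins_eq]] by simp_all
qed

lemma A_partner_join:
  assumes "(a, b) \<in> set (joins P)"
  shows "A_partner a = b" and "A_partner b = a"
proof -
  have "(a, b) \<in> set (all_A_joins P)"
    using assms by (simp add: all_A_joins_def)
  then show "A_partner a = b" "A_partner b = a"
    using partner_of_join[OF distinct_state_joins[of "{}", folded all_A_joins_eq]] by simp_all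
qed

lemma ccw_in_vertex:
  assumes "l \<in> set vertex_lists" and "h \<in> set l"
  shows "ccw P h \<in> set l" and "h \<in> ccw P ` set l" and "A_partner h \<in> set l"
proof -
  have "ccw P h \<in> set l \<and> h \<in> ccw P ` set l \<and> A_partner h \<in> set l"
    using assms(1)
  proof (cases rule: vertex_list_cases)
    case (1 a b c d)
    then show ?thesis
      using assms(2) ccw_crossing[OF 1(1)] A_partner_crossing[OF 1(1)] by auto
  next
    case (2 a b)
    then show ?thesis
      using assms(2) ccw_join[OF 2(1)] A_partner_join[OF 2(1)] by auto
  qed
  then show "ccw P h \<in> set l" "h \<in> ccw P ` set l" "A_partner h \<in> set l" by blast+
qed

lemma bij_ccw: "bij_betw (ccw P) X X"
proof -
  have "ccw P ` X \<subseteq> X" "X \<subseteq> ccw P ` X"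
    unfolding X_eq using ccw_in_vertex by blast+
  then show ?thesis
    using finite_X finite_surj_inj[of X "ccw P"] by (auto simp: bij_betw_def)
qed

lemma right_face_step_op: "h \<in> X \<Longrightarrow> right_face_step P (op h) = ccw P h"
  by (simp add: right_face_step_def op_props)

lemma bij_right_face_step: "bij_betw (right_face_step P) X X"
  using bij_betw_trans[OF bij_op bij_ccw] by (simp add: comp_def right_face_step_def[abs_def])

lemma connected:
  assumes "S \<subseteq> X" and \<phi>: "\<And>h. h \<in> X \<Longrightarrow> right_face_step P h \<in> S \<longleftrightarrow> h \<in> S"
    and o: "\<And>h. h \<in> X \<Longrightarrow> op h \<in> S \<longleftrightarrow> h \<in> S"
  shows "S = {} \<or> S = X"
proof (cases "S = {}")
  case False
  then obtain h where h: "h \<in> S" by blast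
  have "g \<in> S" if g: "g \<in> X" for g
  proof -
    have "(h, g) \<in> equiv_closure ({(x, ccw P x) | x. x \<in> X} \<union> {(x, op x) | x. x \<in> X})"
      using projection h g assms(1) by (auto simp: connected_projection_def connected_diagram_def)
    then have "(h \<in> S) = (g \<in> S)"
    proof (rule equiv_closure_invariant)
      fix u v assume "(u, v) \<in> {(x, ccw P x) | x. x \<in> X} \<union> {(x, op x) | x. x \<in> X}"
      then consider "u \<in> X" "v = ccw P u" | "u \<in> X" "v = op u" by blast
      then show "(u \<in> S) = (v \<in> S)"
      proof cases
        case 1
        then show ?thesis using \<phi>[of "op u"] o[of u] op_props[of u] by (simp add: right_face_step_op)
      next
        case 2
        then show ?thesis using o by simp
      qed
    qed
    with h show ?thesis by simp
  qed
  then show ?thesis using assms(1) by blast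
qed simp

definition vertex_of :: "'h \<Rightarrow> 'h list" where
  "vertex_of h = (THE l. l \<in> set vertex_lists \<and> h \<in> set l)"

lemma vertex_of_eq: "l \<in> set vertex_lists \<Longrightarrow> h \<in> set l \<Longrightarrow> vertex_of h = l"
  unfolding vertex_of_def using vertex_list_unique by (intro the_equality) blast+

lemma vertex_of_image: "vertex_of ` X = set vertex_lists"
proof (intro equalityI subsetI)
  fix l assume "l \<in> vertex_of ` X"
  then show "l \<in> set vertex_lists" unfolding X_eq using vertex_of_eq by auto
next
  fix l assume l: "l \<in> set vertex_lists"
  then have "hd l \<in> set l" by (cases rule: vertex_list_cases) auto
  with l show "l \<in> vertex_of ` X" unfolding X_eq using vertex_of_eq by (metis UN_I image_eqI)
qed

lemma card_vertices: "card (set vertex_lists) = length (crossings P) + length (joins P)"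
proof -
  have "[] \<notin> set vertex_lists" by (auto simp: vertex_lists_def)
  then have "distinct vertex_lists"
    using distinct_halves distinct_if_distinct_concat concat_vertex_lists by metis
  then show ?thesis by (simp add: distinct_card) (simp add: vertex_lists_def)
qed

subsection \<open>The two sides of a circle\<close>

lemma A_circle_of_eq_iff:
  "A_circle_of P x = A_circle_of P y \<longleftrightarrow> (x, y) \<in> circle_rel op (all_A_joins P)"
  unfolding A_circle_of_def circle_rel_def by (rule equiv_closure_class_eq_iff)

lemma mem_A_circle_of: "h \<in> A_circle_of P h"
  by (simp add: A_circle_of_def circle_rel_def)

lemma A_circles_eq: "A_circles P = A_circle_of P ` X"
  unfolding A_circles_def circles_def quotient_eq_image A_circle_of_def
  by (simp add: set_state_joins all_A_joins_eq)

lemma A_circle_of_op: "h \<in> X \<Longrightarrow> A_circle_of P (op h) = A_circle_of P h"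
  unfolding A_circle_of_eq_iff circle_rel_def
  by (rule equiv_closure_sym, rule equiv_closure_base)
     (simp add: set_state_joins all_A_joins_eq)

lemma A_circle_of_partner:
  assumes "h \<in> X"
  shows "A_circle_of P (A_partner h) = A_circle_of P h"
  unfolding A_circle_of_eq_iff circle_rel_def
  using A_partner_props(4)[OF assms]
proof
  assume "(h, A_partner h) \<in> set (all_A_joins P)"
  then show "(A_partner h, h) \<in> equiv_closure (set (all_A_joins P) \<union>
      {(h, op h) | h. h \<in> set (join_halves (all_A_joins P))})"
    by (intro equiv_closure_sym[OF equiv_closure_base] UnI1)
next
  assume "(A_partner h, h) \<in> set (all_A_joins P)"
  then show "(A_partner h, h) \<in> equiv_closure (set (all_A_joins P) \<union>
      {(h, op h) | h. h \<in> set (join_halves (all_A_joins P))})"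
    by (intro equiv_closure_base UnI1)
qed

lemma A_circle_props:
  assumes "C \<in> A_circles P"
  shows "C \<subseteq> X" and "h \<in> X \<Longrightarrow> op h \<in> C \<longleftrightarrow> h \<in> C" and "h \<in> X \<Longrightarrow> A_partner h \<in> C \<longleftrightarrow> h \<in> C"
    and "h \<in> C \<Longrightarrow> A_circle_of P h = C"
proof -
  obtain g where g: "g \<in> X" "C = A_circle_of P g" using assms by (auto simp: A_circles_eq)
  have mem: "h \<in> C \<longleftrightarrow> A_circle_of P h = C" for h
    unfolding g(2) A_circle_of_eq_iff by (auto simp: A_circle_of_def circle_rel_def equiv_closure_sym)
  show "C \<subseteq> X"
  proof
    fix h assume "h \<in> C"
    then have "(g, h) \<in> circle_rel op (all_A_joins P)" by (simp add: g A_circle_of_def)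
    then have "(g \<in> X) = (h \<in> X)"
    proof (rule circle_rel_cases)
      fix u v assume "(u, v) \<in> set (all_A_joins P)"
      then have "u \<in> X" "v \<in> X"
        using set_state_joins[of "{}"] unfolding all_A_joins_eq set_join_halves by force+
      then show "(u \<in> X) = (v \<in> X)" by simp
    next
      fix h assume "h \<in> set (join_halves (all_A_joins P))"
      then show "(op h \<in> X) = (h \<in> X)"
        using op_props by (simp add: set_state_joins all_A_joins_eq)
    qed
    with g show "h \<in> X" by simp
  qed
  show "h \<in> X \<Longrightarrow> op h \<in> C \<longleftrightarrow> h \<in> C" "h \<in> X \<Longrightarrow> A_partner h \<in> C \<longleftrightarrow> h \<in> C"
    "h \<in> C \<Longrightarrow> A_circle_of P h = C"
    by (simp_all add: mem A_circle_of_op A_circle_of_partner)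
qed

lemma A_circle_of_in: "h \<in> X \<Longrightarrow> A_circle_of P h \<in> A_circles P"
  by (simp add: A_circles_eq)

text \<open>
  The Jordan curve theorem for circles of the all-A state.  At every vertex of the diagram a circle
  uses half-edges in pairs of partners, so it is an even set of edges and bounds a set \<open>S\<close> of faces.
\<close>

lemma circle_colouring:
  assumes C: "C \<in> A_circles P"
  obtains S where "\<And>h. h \<in> X \<Longrightarrow> right_face_step P h \<in> S \<longleftrightarrow> h \<in> S"
    and "\<And>h. h \<in> X \<Longrightarrow> op h \<in> S \<longleftrightarrow> (h \<in> S) \<noteq> (h \<in> C)"
proof (rule planar_even_set_is_boundary[where X = X and \<phi> = "right_face_step P" and op = op
      and blk = vertex_of and C = C])
  show "vertex_of (right_face_step P (op h)) = vertex_of h" if h: "h \<in> X" for h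
  proof -
    obtain l where l: "l \<in> set vertex_lists" "h \<in> set l" using h unfolding X_eq by blast
    with ccw_in_vertex[OF l] h show ?thesis
      by (simp add: right_face_step_op vertex_of_eq)
  qed
  show "card (vertex_of ` X) + card (orbit (right_face_step P) ` X) = card (orbit op ` X) + 2"
    using projection unfolding vertex_of_image card_vertices
    by (simp add: connected_projection_def planar_diagram_def)
  show "even (card {g \<in> C. vertex_of g = vertex_of h})" if h: "h \<in> X" for h
  proof (rule even_card_fixpoint_free_involution[where f = A_partner])
    show "finite {g \<in> C. vertex_of g = vertex_of h}"
      using A_circle_props(1)[OF C] finite_X finite_subset by fastforce
    fix g assume "g \<in> {g \<in> C. vertex_of g = vertex_of h}"
    then have g: "g \<in> C" "vertex_of g = vertex_of h" "g \<in> X"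
      using A_circle_props(1)[OF C] by blast+
    then obtain l where l: "l \<in> set vertex_lists" "g \<in> set l" unfolding X_eq by blast
    with ccw_in_vertex[OF l] have "vertex_of (A_partner g) = vertex_of g"
      by (simp add: vertex_of_eq)
    with g show "A_partner g \<in> {g \<in> C. vertex_of g = vertex_of h} \<and> A_partner g \<noteq> g \<and>
        A_partner (A_partner g) = g"
      using A_circle_props(3)[OF C] A_partner_props by simp
  qed
  show "finite X" by (rule finite_X)
  show "bij_betw (right_face_step P) X X" by (rule bij_right_face_step)
  show "op h \<in> X \<and> op h \<noteq> h \<and> op (op h) = h" if "h \<in> X" for h
    using that by (rule op_props)
  show "S = {} \<or> S = X"
    if "S \<subseteq> X" "\<And>h. h \<in> X \<Longrightarrow> right_face_step P h \<in> S \<longleftrightarrow> h \<in> S" "\<And>h. h \<in> X \<Longrightarrow> op h \<in> S \<longleftrightarrow> h \<in> S"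
    for S
    using that by (rule connected)
  show "C \<subseteq> X" using C by (rule A_circle_props(1))
  show "op h \<in> C \<longleftrightarrow> h \<in> C" if "h \<in> X" for h
    using C that by (rule A_circle_props(2))
qed (rule that)

lemma same_side_sym: "(x, y) \<in> same_side P C \<Longrightarrow> (y, x) \<in> same_side P C"
  unfolding same_side_def by (rule equiv_closure_sym)

lemma same_side_trans:
  "(x, y) \<in> same_side P C \<Longrightarrow> (y, z) \<in> same_side P C \<Longrightarrow> (x, z) \<in> same_side P C"
  unfolding same_side_def by (rule equiv_closure_trans)

lemma same_side_refl: "(x, x) \<in> same_side P C"
  unfolding same_side_def by simp

lemma same_side_face: "h \<in> X \<Longrightarrow> (h, right_face_step P h) \<in> same_side P C"
  unfolding same_side_def by (rule equiv_closure_base) blast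

lemma same_side_op: "h \<in> X \<Longrightarrow> h \<notin> C \<Longrightarrow> (h, op h) \<in> same_side P C"
  unfolding same_side_def by (rule equiv_closure_base) blast

lemma same_side_crossing: "(a, b, c, d) \<in> set (crossings P) \<Longrightarrow> (a, c) \<in> same_side P C"
  unfolding same_side_def by (rule equiv_closure_base) blast

text \<open>
  Whoever travels along the state stays on the same side of every circle.  At the end of an edge
  the traveller turns into the next half-edge of the face to the right, or passes the splice along
  the corner that was merged with it.
\<close>

lemma same_side_travel:
  assumes "h \<in> X"
  shows "(h, travel P h) \<in> same_side P C"
proof -
  have f: "(h, ccw P (op h)) \<in> same_side P C"
    using same_side_face[OF assms] by (simp add: right_face_step_def)
  obtain l where "l \<in> set vertex_lists" "op h \<in> set l" using assms op_props unfolding X_eq by blast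
  from this(1) show ?thesis
  proof (cases rule: vertex_list_cases)
    case (1 a b c d)
    have ac: "(a, c) \<in> same_side P C" using 1(1) by (rule same_side_crossing)
    from \<open>op h \<in> set l\<close> 1(2) consider "op h = a" | "op h = b" | "op h = c" | "op h = d" by auto
    then show ?thesis
      using f ac same_side_trans[OF _ ac] same_side_trans[OF _ same_side_sym[OF ac]]
      by cases (simp_all add: travel_def A_partner_crossing[OF 1(1)] ccw_crossing[OF 1(1)])
  next
    case (2 a b)
    from \<open>op h \<in> set l\<close> 2(2) consider "op h = a" | "op h = b" by auto
    then show ?thesis
      using f by cases (simp_all add: travel_def A_partner_join[OF 2(1)] ccw_join[OF 2(1)])
  qed
qed

text \<open>
  The faces in the set bounded by \<open>C\<close> and the remaining faces are never on the same side of \<open>C\<close>.  The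
  corners to the right of \<open>a\<close> and of \<open>c\<close> are separated by the half-edges \<open>a\<close> and \<open>b\<close>.  As these are
  partners, \<open>C\<close> contains both or none, and the number of crossings of \<open>C\<close> between the corners is
  even.
\<close>

lemma circle_separates:
  assumes C: "C \<in> A_circles P" and h: "h \<in> C"
  shows "(h, op h) \<notin> same_side P C"
proof
  have hX: "h \<in> X" using A_circle_props(1)[OF C] h by blast
  obtain S where \<phi>: "\<And>h. h \<in> X \<Longrightarrow> right_face_step P h \<in> S \<longleftrightarrow> h \<in> S"
    and o: "\<And>h. h \<in> X \<Longrightarrow> op h \<in> S \<longleftrightarrow> (h \<in> S) \<noteq> (h \<in> C)"
    using circle_colouring[OF C] by blast
  assume "(h, op h) \<in> same_side P C"
  then have "(h \<in> S) = (op h \<in> S)"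
    unfolding same_side_def
  proof (rule equiv_closure_invariant)
    fix u v
    assume "(u, v) \<in> {(h, right_face_step P h) | h. h \<in> X} \<union> {(h, op h) | h. h \<in> X - C} \<union>
      {(a, c) | a b c d. (a, b, c, d) \<in> set (crossings P)}"
    then consider "u \<in> X" "v = right_face_step P u" | "u \<in> X" "u \<notin> C" "v = op u"
      | b d where "(u, b, v, d) \<in> set (crossings P)" by blast
    then show "(u \<in> S) = (v \<in> S)"
    proof cases
      case 3
      note x = crossing_distinct[OF 3]
      have "ccw P g \<in> S \<longleftrightarrow> (g \<in> S) \<noteq> (g \<in> C)" if "g \<in> X" for g
        using \<phi>[of "op g"] o[OF that] op_props[OF that] by (simp add: right_face_step_op that)
      from this[of u] this[of b] have "b \<in> S \<longleftrightarrow> (u \<in> S) \<noteq> (u \<in> C)" "v \<in> S \<longleftrightarrow> (b \<in> S) \<noteq> (b \<in> C)"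
        using x ccw_crossing[OF 3] by simp_all
      moreover have "b \<in> C \<longleftrightarrow> u \<in> C"
        using A_circle_props(3)[OF C, of u] x A_partner_crossing[OF 3] by simp
      ultimately show ?thesis by blast
    qed (use \<phi> o in auto)
  qed
  with o[OF hX] h show False by simp
qed

text \<open>
  All half-edges of \<open>C\<close> have one side in common with \<open>h\<close> and the other with \<open>op h\<close>, because travelling
  preserves both.  Away from \<open>C\<close> edges may be crossed, so that connectedness takes care of the rest of
  the diagram.
\<close>

lemma circle_has_two_sides:
  assumes C: "C \<in> A_circles P" and h: "h \<in> C" and g: "g \<in> X"
  shows "(h, g) \<in> same_side P C \<or> (op h, g) \<in> same_side P C"
proof -
  have hX: "h \<in> X" using A_circle_props(1)[OF C] h by blast
  let ?T = "{g \<in> X. (h, g) \<in> same_side P C \<or> (op h, g) \<in> same_side P C}"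
  let ?f = "\<lambda>g. (h, g) \<in> same_side P C \<and> (op h, op g) \<in> same_side P C \<or>
    (op h, g) \<in> same_side P C \<and> (h, op g) \<in> same_side P C"
  have on_circle: "?f g" if "g \<in> C" for g
  proof -
    have "(h, g) \<in> circle_rel op (all_A_joins P)"
      using A_circle_props(4)[OF C] h that by (simp flip: A_circle_of_eq_iff)
    then have "?f h = ?f g"
    proof (rule circle_rel_cases)
      fix u v assume uv: "(u, v) \<in> set (all_A_joins P)"
      have *: "?f v" if "?f u" "u \<in> X" "A_partner u = v" "v \<in> X" "A_partner v = u" for u v
      proof -
        have "(op u, v) \<in> same_side P C" "(op v, u) \<in> same_side P C"
          using same_side_travel[of "op u" C] same_side_travel[of "op v" C] that op_props
          by (simp_all add: travel_def)
        with that(1) show ?thesis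
          using same_side_trans[of h "op u" C v] same_side_trans[of "op h" "op u" C v]
            same_side_trans[of h u C "op v"] same_side_trans[of "op h" u C "op v"]
            same_side_sym by blast
      qed
      have "u \<in> X" "v \<in> X"
        using uv set_state_joins[of "{}"] unfolding all_A_joins_eq set_join_halves by force+
      moreover have "A_partner u = v" "A_partner v = u"
        using partner_of_join[OF distinct_state_joins[of "{}"]] uv by (simp_all add: all_A_joins_eq)
      ultimately show "?f u = ?f v"
        using *[of u v] *[of v u] by blast
    next
      fix g assume "g \<in> set (join_halves (all_A_joins P))"
      then have "op (op g) = g" using op_props by (simp add: set_state_joins all_A_joins_eq)
      then show "?f (op g) = ?f g" by auto
    qed
    moreover have "?f h" by (simp add: same_side_refl)
    ultimately show ?thesis by simp
  qed
  have "?T = {} \<or> ?T = X"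
  proof (rule connected)
    show "right_face_step P g \<in> ?T \<longleftrightarrow> g \<in> ?T" if "g \<in> X" for g
    proof -
      have "right_face_step P g \<in> X" using that bij_right_face_step by (auto simp: bij_betw_def)
      moreover have "(k, right_face_step P g) \<in> same_side P C \<longleftrightarrow> (k, g) \<in> same_side P C" for k
        using same_side_face[OF that, of C] same_side_trans same_side_sym by metis
      ultimately show ?thesis using that by simp
    qed
    show "op g \<in> ?T \<longleftrightarrow> g \<in> ?T" if gX: "g \<in> X" for g
    proof (cases "g \<in> C")
      case True
      then show ?thesis using on_circle[OF True] gX op_props[OF gX] by auto
    next
      case False
      have "(k, op g) \<in> same_side P C \<longleftrightarrow> (k, g) \<in> same_side P C" for k
        using same_side_op[OF gX False] same_side_trans same_side_sym by metis
      then show ?thesis using gX op_props[OF gX] by simp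
    qed
  qed blast
  moreover have "h \<in> ?T" using hX same_side_refl by simp
  ultimately show ?thesis using g by blast
qed

subsection \<open>The direction of a circle\<close>

text \<open>
  Exactly one of the two sides of a circle contains the unbounded face.
\<close>

lemma clockwise_op: "h \<in> X \<Longrightarrow> clockwise P (op h) \<longleftrightarrow> \<not> clockwise P h"
proof -
  assume h: "h \<in> X"
  let ?C = "A_circle_of P h"
  have C: "?C \<in> A_circles P" using h by (rule A_circle_of_in)
  have "(h, outer P) \<in> same_side P ?C \<or> (op h, outer P) \<in> same_side P ?C"
    using C mem_A_circle_of outer_in_X by (rule circle_has_two_sides)
  moreover have "(h, op h) \<notin> same_side P ?C"
    using C mem_A_circle_of by (rule circle_separates)
  ultimately show ?thesis
    unfolding clockwise_def A_circle_of_op[OF h]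
    using same_side_sym same_side_trans by metis
qed

lemma A_circle_of_travel: "h \<in> X \<Longrightarrow> A_circle_of P (travel P h) = A_circle_of P h"
  by (simp add: travel_def A_circle_of_partner A_circle_of_op op_props)

lemma clockwise_travel: "h \<in> X \<Longrightarrow> clockwise P (travel P h) \<longleftrightarrow> clockwise P h"
  unfolding clockwise_def A_circle_of_travel
  using same_side_travel same_side_sym same_side_trans by metis

lemma positively_directed_op: "h \<in> X \<Longrightarrow> positively_directed P (op h) \<longleftrightarrow> \<not> positively_directed P h"
  by (simp add: positively_directed_def A_circle_of_op clockwise_op)

lemma positively_directed_travel:
  "h \<in> X \<Longrightarrow> positively_directed P (travel P h) \<longleftrightarrow> positively_directed P h"
  by (simp add: positively_directed_def A_circle_of_travel clockwise_travel)

lemma positively_directed_partner: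
  assumes "h \<in> X"
  shows "positively_directed P (A_partner h) \<longleftrightarrow> \<not> positively_directed P h"
proof -
  have "A_partner h = travel P (op h)" using assms by (simp add: travel_def op_props)
  then show ?thesis
    using assms op_props positively_directed_travel[of "op h"] positively_directed_op by simp
qed

text \<open>
  Disjoint circles do not cross, so any half-edge of \<open>C\<close> decides on which side of \<open>C'\<close> it lies.
\<close>

lemma lies_inside_iff:
  assumes C: "C \<in> A_circles P" and C': "C' \<in> A_circles P" and "C \<noteq> C'" and a: "a \<in> C"
  shows "lies_inside P C C' \<longleftrightarrow> (outer P, a) \<notin> same_side P C'"
proof -
  have disj: "h \<notin> C'" if "h \<in> C" for h
    using A_circle_props(4)[OF C that] A_circle_props(4)[OF C', of h] assms(3) by auto
  have "((outer P, a) \<in> same_side P C') = ((outer P, h) \<in> same_side P C')" if h: "h \<in> C" for h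
  proof -
    have "(a, h) \<in> circle_rel op (all_A_joins P)"
      using A_circle_props(4)[OF C] h a by (simp flip: A_circle_of_eq_iff)
    then have "(a \<in> C \<longrightarrow> (outer P, a) \<in> same_side P C') = (h \<in> C \<longrightarrow> (outer P, h) \<in> same_side P C')"
    proof (rule circle_rel_cases)
      fix g assume "g \<in> set (join_halves (all_A_joins P))"
      then have g: "g \<in> X" by (simp add: set_state_joins all_A_joins_eq)
      have "(g, op g) \<in> same_side P C'" if "g \<in> C" using same_side_op[OF g] disj[OF that] .
      then show "(op g \<in> C \<longrightarrow> (outer P, op g) \<in> same_side P C') =
          (g \<in> C \<longrightarrow> (outer P, g) \<in> same_side P C')"
        using A_circle_props(2)[OF C g] same_side_trans same_side_sym by metis
    next
      fix u v assume uv: "(u, v) \<in> set (all_A_joins P)"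
      have u: "u \<in> X" and v: "A_partner u = v"
        using uv set_state_joins[of "{}"] partner_of_join[OF distinct_state_joins[of "{}"]] uv
        unfolding all_A_joins_eq set_join_halves by force+
      have "(u, op u) \<in> same_side P C'" if "u \<in> C" using same_side_op[OF u] disj[OF that] .
      moreover have "(op u, v) \<in> same_side P C'"
        using same_side_travel[of "op u" C'] v op_props[OF u] by (simp add: travel_def)
      ultimately show "(u \<in> C \<longrightarrow> (outer P, u) \<in> same_side P C') =
          (v \<in> C \<longrightarrow> (outer P, v) \<in> same_side P C')"
        using A_circle_props(3)[OF C u] v same_side_trans same_side_sym by metis
    qed
    with a h show ?thesis by simp
  qed
  then show ?thesis unfolding lies_inside_def using assms(3) a by blast
qed

text \<open>
  The arc of a crossing connects \<open>Ca\<close> with \<open>Cc\<close> without meeting a third circle.  Every third circle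
  therefore contains both or none of them, and \<open>Cc\<close> contains \<open>Ca\<close> iff the arc leaves \<open>Cc\<close> on its
  inner side, that is, iff \<open>c\<close> points clockwise.
\<close>

lemma nesting_across_crossing:
  assumes Ca: "Ca \<in> A_circles P" and Cc: "Cc \<in> A_circles P" and "Ca \<noteq> Cc"
    and a: "a \<in> Ca" and c: "c \<in> Cc" and ac: "\<And>C. (a, c) \<in> same_side P C"
  shows "nesting P Ca = card {C \<in> A_circles P - {Ca, Cc}. (outer P, a) \<notin> same_side P C}
           + (if clockwise P c then 1 else 0)"
proof -
  let ?N = "{C \<in> A_circles P - {Ca, Cc}. (outer P, a) \<notin> same_side P C}"
  have "lies_inside P Ca Cc \<longleftrightarrow> clockwise P c"
    using lies_inside_iff[OF Ca Cc assms(3) a] A_circle_props(4)[OF Cc c]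
      same_side_trans[OF _ ac] same_side_trans[OF _ same_side_sym[OF ac]]
    unfolding clockwise_def by metis
  then have "C \<in> A_circles P \<and> lies_inside P Ca C \<longleftrightarrow>
      C \<in> ?N \<union> (if clockwise P c then {Cc} else {})" for C
    using Ca Cc assms(3) lies_inside_iff[OF Ca _ _ a, of C]
    by (cases "C = Ca"; cases "C = Cc") (auto simp: lies_inside_def[of P Ca Ca])
  then have "{C \<in> A_circles P. lies_inside P Ca C} = ?N \<union> (if clockwise P c then {Cc} else {})"
    by blast
  moreover have "finite ?N" using finite_X by (simp add: A_circles_eq)
  ultimately show ?thesis by (simp add: nesting_def)
qed

text \<open>
  This is what the alternating orientation of nested circles achieves.  If the two ends of the arc are
  on different circles and \<open>N\<close> further circles contain them, the nesting of the circle of \<open>a\<close> is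
  \<open>N\<close>, plus one if \<open>c\<close> is clockwise, and conversely.  Both sides of the claim thus express the same
  symmetric relation between the directions of \<open>a\<close> and \<open>c\<close> and the parity of \<open>N\<close>.
\<close>

lemma positively_directed_crossing:
  assumes x: "(a, b, c, d) \<in> set (crossings P)"
  shows "positively_directed P a \<longleftrightarrow> positively_directed P c"
proof -
  note ac = same_side_crossing[OF x] and X = crossing_distinct[OF x]
  let ?Ca = "A_circle_of P a" and ?Cc = "A_circle_of P c"
  have iff: "(outer P, a) \<in> same_side P C \<longleftrightarrow> (outer P, c) \<in> same_side P C" for C
    using ac same_side_sym same_side_trans by metis
  show ?thesis
  proof (cases "?Ca = ?Cc")
    case True
    then show ?thesis by (simp add: positively_directed_def clockwise_def iff)
  next
    case False
    note C = A_circle_of_in[OF X(2)] A_circle_of_in[OF X(4)]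
    have "nesting P ?Ca = card {C \<in> A_circles P - {?Ca, ?Cc}. (outer P, a) \<notin> same_side P C}
        + (if clockwise P c then 1 else 0)"
      using C False mem_A_circle_of mem_A_circle_of ac by (rule nesting_across_crossing)
    moreover have "nesting P ?Cc = card {C \<in> A_circles P - {?Cc, ?Ca}. (outer P, c) \<notin> same_side P C}
        + (if clockwise P a then 1 else 0)"
      using C(2,1) False[symmetric] mem_A_circle_of mem_A_circle_of same_side_sym[OF ac]
      by (rule nesting_across_crossing)
    moreover have "{C \<in> A_circles P - {?Cc, ?Ca}. (outer P, c) \<notin> same_side P C} =
        {C \<in> A_circles P - {?Ca, ?Cc}. (outer P, a) \<notin> same_side P C}"
      unfolding iff by (simp only: insert_commute)
    ultimately show ?thesis
      unfolding positively_directed_def by (simp split: if_splits)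
  qed
qed

end

section \<open>Circles of states and faces of sub-dessins\<close>

text \<open>
  A set \<open>Q\<close> with exactly one half of every edge and of every join directs all circles of the state.
  Walking in this direction, a circle is a single orbit instead of a class of an equivalence
  relation.
\<close>

lemma coherently_oriented_circles:
  fixes op :: "'h \<Rightarrow> 'h"
  defines "\<tau> js \<equiv> \<lambda>h. partner js (op h)"
  assumes dist: "distinct (join_halves js)"
    and op: "\<And>h. h \<in> set (join_halves js) \<Longrightarrow> op h \<in> set (join_halves js) \<and> op (op h) = h"
    and Q: "Q \<subseteq> set (join_halves js)"
    and Q_op: "\<And>h. h \<in> set (join_halves js) \<Longrightarrow> op h \<in> Q \<longleftrightarrow> h \<notin> Q"
    and Q_join: "\<And>x y. (x, y) \<in> set js \<Longrightarrow> x \<in> Q \<longleftrightarrow> y \<notin> Q"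
  shows "bij_betw (\<tau> js) Q Q"
    and "x \<in> Q \<Longrightarrow> y \<in> Q \<Longrightarrow> (x, y) \<in> circle_rel op js \<longleftrightarrow> orbit (\<tau> js) x = orbit (\<tau> js) y"
    and "card (circles op js) = card (orbit (\<tau> js) ` Q)"
proof -
  let ?X = "set (join_halves js)" and ?t = "\<tau> js"
  note pp = partner_props[OF dist]
  have finQ: "finite Q" using Q finite_subset by blast
  have tQ: "?t h \<in> Q" if "h \<in> Q" for h
  proof -
    have h: "op h \<in> ?X" "op h \<notin> Q" using that Q op Q_op by blast+
    then show ?thesis
      using pp(4)[OF h(1)] Q_join[of "op h" "?t h"] Q_join[of "?t h" "op h"] unfolding \<tau>_def by blast
  qed
  have "inj_on ?t Q"
  proof (rule inj_onI)
    fix x y assume "x \<in> Q" "y \<in> Q" and eq: "?t x = ?t y"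
    then have X: "x \<in> ?X" "y \<in> ?X" using Q by blast+
    then have "op x = op y" using eq pp(3) op unfolding \<tau>_def by metis
    then show "x = y" using op X by metis
  qed
  moreover from this have "?t ` Q = Q"
    using finQ tQ by (intro endo_inj_surj) auto
  ultimately show bij: "bij_betw ?t Q Q" by (simp add: bij_betw_def)
  note eq_iff = orbit_eq_iff_bij[OF finQ bij]
  have base: "(h, op h) \<in> circle_rel op js" if "h \<in> ?X" for h
    unfolding circle_rel_def by (rule equiv_closure_base) (use that in blast)
  have join: "(h, partner js h) \<in> circle_rel op js" if "h \<in> ?X" for h
    using pp(4)[OF that] unfolding circle_rel_def
    by (elim disjE) (intro equiv_closure_base UnI1, assumption,
        intro equiv_closure_sym[OF equiv_closure_base] UnI1, assumption)
  have step: "(h, ?t h) \<in> circle_rel op js" if "h \<in> ?X" for h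
    using base[OF that] join[of "op h"] op[OF that] unfolding \<tau>_def circle_rel_def
    by (blast intro: equiv_closure_trans)
  show rel: "(x, y) \<in> circle_rel op js \<longleftrightarrow> orbit ?t x = orbit ?t y" if xy: "x \<in> Q" "y \<in> Q" for x y
  proof
    assume "orbit ?t x = orbit ?t y"
    then have "y \<in> orbit ?t x" using eq_iff xy by blast
    then have "y \<in> ?X \<and> (x, y) \<in> circle_rel op js"
    proof induction
      case base
      then show ?case using step[of x] xy tQ Q by blast
    next
      case (step y)
      have "?t y \<in> ?X" using step op pp(1)[of "op y"] unfolding \<tau>_def by blast
      with step \<open>\<And>h. h \<in> ?X \<Longrightarrow> (h, ?t h) \<in> circle_rel op js\<close>[of y] show ?case
        unfolding circle_rel_def by (blast intro: equiv_closure_trans)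
    qed
    then show "(x, y) \<in> circle_rel op js" by blast
  next
    \<comment> \<open>The orbit that follows the edge of \<open>h\<close> in the direction given by \<open>Q\<close> is the same all along a circle.\<close>
    let ?g = "\<lambda>h. orbit ?t (if h \<in> Q then h else op h)"
    have g_join: "?g u = ?g v" if "u \<in> Q" "v \<notin> Q" "v \<in> ?X" "partner js v = u" for u v
    proof -
      have "op v \<in> Q" "?t (op v) = u" using that Q_op op by (simp_all add: \<tau>_def)
      then have "u \<in> orbit ?t (op v)" by (metis orbit.base)
      then show ?thesis using eq_iff[OF \<open>op v \<in> Q\<close> that(1)] that by simp
    qed
    assume "(x, y) \<in> circle_rel op js"
    then have "?g x = ?g y"
    proof (rule circle_rel_cases)
      fix u v assume uv: "(u, v) \<in> set js"
      then have "u \<in> ?X" "v \<in> ?X" by (force simp: set_join_halves)+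
      then show "?g u = ?g v"
        using g_join[of u v] g_join[of v u] Q_join[OF uv] partner_of_join[OF dist uv]
        by (cases "u \<in> Q") simp_all
    next
      fix h assume "h \<in> ?X"
      then show "?g (op h) = ?g h" using op Q_op by simp
    qed
    then show "orbit ?t x = orbit ?t y" using xy by simp
  qed
  have "circles op js = (\<lambda>h. circle_rel op js `` {h}) ` Q"
    unfolding circles_def quotient_eq_image
  proof (intro equalityI subsetI)
    fix K assume "K \<in> (\<lambda>h. circle_rel op js `` {h}) ` ?X"
    then obtain h where h: "h \<in> ?X" "K = circle_rel op js `` {h}" by blast
    have "circle_rel op js `` {h} = circle_rel op js `` {op h}"
      using base[OF h(1)] unfolding circle_rel_def equiv_closure_class_eq_iff .
    then show "K \<in> (\<lambda>h. circle_rel op js `` {h}) ` Q"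
      using h Q_op[OF h(1)] by (cases "h \<in> Q") auto
  qed (use Q in blast)
  also have "card \<dots> = card (orbit ?t ` Q)"
  proof (rule card_image_eq_if_same_kernel)
    fix x y assume "x \<in> Q" "y \<in> Q"
    then show "circle_rel op js `` {x} = circle_rel op js `` {y} \<longleftrightarrow> orbit ?t x = orbit ?t y"
      using rel by (simp only: circle_rel_def equiv_closure_class_eq_iff)
  qed
  finally show "card (circles op js) = card (orbit ?t ` Q)" .
qed

lemma set_state_joins_iff:
  "(u, v) \<in> set (state_joins P F) \<longleftrightarrow>
     (\<exists>x\<in>set (crossings P). (u, v) \<in> set (if x \<in> F then B_splice x else A_splice x)) \<or>
     (u, v) \<in> set (joins P)"
  by (auto simp: state_joins_def)

fun other_end :: "'e \<times> bool \<Rightarrow> 'e \<times> bool" where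
  "other_end (e, b) = (e, \<not> b)"

lemma other_end_other_end [simp]: "other_end (other_end x) = x"
  by (cases x) simp

lemma arc_end_halves_subset: "arc_end_halves (x, b) \<subseteq> set (crossing_halves x)"
  by (cases x; cases b) auto

context plane_diagram
begin

definition Pos :: "'h set" where
  "Pos = {h \<in> X. positively_directed P h}"

lemma Pos_subset: "Pos \<subseteq> X"
  by (auto simp: Pos_def)

lemma finite_Pos: "finite Pos"
  using Pos_subset finite_X finite_subset by blast

lemma Pos_crossing:
  assumes x: "(a, b, c, d) \<in> set (crossings P)"
  shows "b \<in> Pos \<longleftrightarrow> a \<notin> Pos" and "c \<in> Pos \<longleftrightarrow> a \<in> Pos" and "d \<in> Pos \<longleftrightarrow> a \<notin> Pos"
  using crossing_distinct[OF x] positively_directed_partner[of a] positively_directed_partner[of c]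
    A_partner_crossing[OF x] positively_directed_crossing[OF x]
  by (auto simp: Pos_def)

text \<open>
  At a crossing \<open>(a, b, c, d)\<close> the positive half-edges are \<open>a\<close> and \<open>c\<close>, or \<open>b\<close> and \<open>d\<close>.  In both cases
  either splicing joins a positive with a negative half-edge.  So the orientation of the all-A
  state directs the circles of all states at once, which makes the states comparable with ribbon
  surfaces that are oriented.
\<close>

lemma Pos_state_join:
  assumes "(u, v) \<in> set (state_joins P F)"
  shows "u \<in> Pos \<longleftrightarrow> v \<notin> Pos"
  using assms unfolding set_state_joins_iff
proof (elim disjE bexE)
  fix x assume x: "x \<in> set (crossings P)"
    "(u, v) \<in> set (if x \<in> F then B_splice x else A_splice x)"
  obtain a b c d where "x = (a, b, c, d)" by (cases x)
  with x Pos_crossing[of a b c d] show ?thesis by (auto split: if_splits)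
next
  assume uv: "(u, v) \<in> set (joins P)"
  then have "u \<in> X" "v \<in> X" unfolding X_eq by (auto intro!: bexI[OF _ join_vertex_list[OF uv]])
  with positively_directed_partner[of u] A_partner_join[OF uv] show ?thesis
    by (simp add: Pos_def)
qed

definition state_travel :: "'h crossing set \<Rightarrow> 'h \<Rightarrow> 'h" where
  "state_travel F h = partner (state_joins P F) (op h)"

lemma travel_eq: "travel P = state_travel {}"
  by (simp add: fun_eq_iff travel_def state_travel_def all_A_joins_eq)

lemma Pos_op: "h \<in> X \<Longrightarrow> op h \<in> Pos \<longleftrightarrow> h \<notin> Pos"
  by (simp add: Pos_def positively_directed_op op_props)

lemma state_circles:
  shows "bij_betw (state_travel F) Pos Pos"
    and "x \<in> Pos \<Longrightarrow> y \<in> Pos \<Longrightarrow>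
      (x, y) \<in> circle_rel op (state_joins P F) \<longleftrightarrow> orbit (state_travel F) x = orbit (state_travel F) y"
    and "card (circles op (state_joins P F)) = card (orbit (state_travel F) ` Pos)"
proof -
  let ?js = "state_joins P F"
  have eq: "state_travel F = (\<lambda>h. partner ?js (op h))"
    by (simp add: fun_eq_iff state_travel_def)
  have "op h \<in> set (join_halves ?js) \<and> op (op h) = h" if "h \<in> set (join_halves ?js)" for h
    using that op_props by (simp add: set_state_joins)
  moreover have "Pos \<subseteq> set (join_halves ?js)"
    by (simp add: set_state_joins Pos_subset)
  moreover have "op h \<in> Pos \<longleftrightarrow> h \<notin> Pos" if "h \<in> set (join_halves ?js)" for h
    using that by (simp add: set_state_joins Pos_op)
  ultimately have prem: "distinct (join_halves ?js)"
    "\<And>h. h \<in> set (join_halves ?js) \<Longrightarrow> op h \<in> set (join_halves ?js) \<and> op (op h) = h"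
    "Pos \<subseteq> set (join_halves ?js)"
    "\<And>h. h \<in> set (join_halves ?js) \<Longrightarrow> op h \<in> Pos \<longleftrightarrow> h \<notin> Pos"
    "\<And>x y. (x, y) \<in> set ?js \<Longrightarrow> x \<in> Pos \<longleftrightarrow> y \<notin> Pos"
    using distinct_state_joins Pos_state_join by blast+
  show "bij_betw (state_travel F) Pos Pos"
    unfolding eq by (rule coherently_oriented_circles(1); rule prem)
  show "x \<in> Pos \<Longrightarrow> y \<in> Pos \<Longrightarrow>
      (x, y) \<in> circle_rel op ?js \<longleftrightarrow> orbit (state_travel F) x = orbit (state_travel F) y"
    unfolding eq by (rule coherently_oriented_circles(2); (assumption | rule prem))
  show "card (circles op ?js) = card (orbit (state_travel F) ` Pos)"
    unfolding eq by (rule coherently_oriented_circles(3); rule prem)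
qed

lemma bij_travel: "bij_betw (travel P) Pos Pos"
  unfolding travel_eq by (rule state_circles)

lemma A_circle_of_eq_iff_orbit:
  "x \<in> Pos \<Longrightarrow> y \<in> Pos \<Longrightarrow> A_circle_of P x = A_circle_of P y \<longleftrightarrow> orbit (travel P) x = orbit (travel P) y"
  unfolding A_circle_of_eq_iff travel_eq all_A_joins_eq by (rule state_circles)

lemma arc_end_halves_unique:
  assumes "x \<in> arc_ends P" and "y \<in> arc_ends P" and "h \<in> arc_end_halves x" and "h \<in> arc_end_halves y"
  shows "x = y"
proof -
  obtain e b f b' where xy: "x = (e, b)" "y = (f, b')" by (cases x; cases y)
  have "h \<in> set (crossing_halves e)" "h \<in> set (crossing_halves f)"
    using subsetD[OF arc_end_halves_subset, of h e b] subsetD[OF arc_end_halves_subset, of h f b']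
      assms(3,4) unfolding xy by simp_all
  moreover have "e \<in> set (crossings P)" "f \<in> set (crossings P)"
    using assms(1,2) xy by (simp_all add: arc_ends_def)
  ultimately have "e = f" by (intro crossing_unique)
  moreover obtain p q r s where e: "e = (p, q, r, s)" by (cases e)
  moreover have "distinct [p, q, r, s]"
    using assms(1) crossing_distinct(1) by (simp add: xy e arc_ends_def)
  ultimately show ?thesis
    using assms(3,4) xy by (cases b; cases b') auto
qed

lemma arc_end_of_eq: "x \<in> arc_ends P \<Longrightarrow> h \<in> arc_end_halves x \<Longrightarrow> arc_end_of P h = x"
  unfolding arc_end_of_def using arc_end_halves_unique by (intro the_equality) blast+

lemma departure_crossing:
  assumes x: "(a, b, c, d) \<in> set (crossings P)"
  shows "departure P ((a, b, c, d), True) = (if a \<in> Pos then a else b)"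
    and "departure P ((a, b, c, d), False) = (if a \<in> Pos then c else d)"
  using Pos_crossing[OF x] crossing_distinct[OF x]
  unfolding departure_def by (auto simp: Pos_def intro!: the_equality)

lemma departure_props:
  assumes "x \<in> arc_ends P"
  shows "departure P x \<in> arc_end_halves x" and "departure P x \<in> Pos"
    and "h \<in> arc_end_halves x \<Longrightarrow> h \<in> Pos \<Longrightarrow> h = departure P x"
proof -
  obtain a b c d t where x: "x = ((a, b, c, d), t)" by (cases x) auto
  then have c: "(a, b, c, d) \<in> set (crossings P)" using assms by (simp add: arc_ends_def)
  show "departure P x \<in> arc_end_halves x" "departure P x \<in> Pos"
    "h \<in> arc_end_halves x \<Longrightarrow> h \<in> Pos \<Longrightarrow> h = departure P x"
    unfolding x using Pos_crossing[OF c] departure_crossing[OF c] by (cases t; auto)+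
qed

lemma arc_end_of_departure: "x \<in> arc_ends P \<Longrightarrow> arc_end_of P (departure P x) = x"
  using arc_end_of_eq departure_props(1) by blast

lemma inj_departure: "inj_on (departure P) (arc_ends P)"
  by (rule inj_on_inverseI[where g = "arc_end_of P"]) (rule arc_end_of_departure)

lemma departure_arc_end_of:
  assumes "h \<in> crossing_half_set P" and "h \<in> Pos"
  shows "arc_end_of P h \<in> arc_ends P" and "departure P (arc_end_of P h) = h"
proof -
  obtain x where x: "x \<in> arc_ends P" "h \<in> arc_end_halves x"
    using assms(1) by (auto simp: crossing_half_set_def)
  with arc_end_of_eq have "arc_end_of P h = x" by blast
  with x departure_props(3)[OF x assms(2)] show "arc_end_of P h \<in> arc_ends P"
    "departure P (arc_end_of P h) = h" by simp_all
qed

lemma departure_in_crossing_half_set: "x \<in> arc_ends P \<Longrightarrow> departure P x \<in> crossing_half_set P"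
  unfolding crossing_half_set_def using departure_props(1) by blast

lemma arc_end_circle_eq:
  assumes "x \<in> arc_ends P"
  shows "arc_end_circle P x = A_circle_of P (departure P x)"
  unfolding arc_end_circle_def
proof (rule the_equality)
  obtain a b c d t where x: "x = ((a, b, c, d), t)" by (cases x) auto
  then have c: "(a, b, c, d) \<in> set (crossings P)" using assms by (simp add: arc_ends_def)
  note X = crossing_distinct[OF c]
  have "A_circle_of P b = A_circle_of P a" "A_circle_of P d = A_circle_of P c"
    using A_circle_of_partner[of a] A_circle_of_partner[of c] X A_partner_crossing[OF c] by simp_all
  then have "arc_end_halves x \<subseteq> A_circle_of P (departure P x)"
    using mem_A_circle_of[of a] mem_A_circle_of[of b] mem_A_circle_of[of c] mem_A_circle_of[of d]
    unfolding x by (cases t) (simp_all add: departure_crossing[OF c])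
  then show "A_circle_of P (departure P x) \<in> A_circles P \<and> arc_end_halves x \<subseteq> A_circle_of P (departure P x)"
    using A_circle_of_in departure_props(2)[OF assms] Pos_subset by blast
next
  fix C assume "C \<in> A_circles P \<and> arc_end_halves x \<subseteq> C"
  then show "C = A_circle_of P (departure P x)"
    using A_circle_props(4)[of C "departure P x"] departure_props(1)[OF assms] by blast
qed

lemma next_arc_end_props:
  assumes "x \<in> arc_ends P"
  shows "next_arc_end P x \<in> arc_ends P"
    and "departure P (next_arc_end P x) = first_return (travel P) (crossing_half_set P) (departure P x)"
proof -
  let ?h = "first_return (travel P) (crossing_half_set P) (departure P x)"
  note d = departure_props(2)[OF assms]
  have "departure P x \<in> orbit (travel P) (departure P x)"
    using self_in_orbit_bij[OF finite_Pos bij_travel d] .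
  then have "orbit (travel P) (departure P x) \<inter> crossing_half_set P \<noteq> {}"
    using departure_in_crossing_half_set[OF assms] by blast
  then have "?h \<in> crossing_half_set P" using first_return_in by fast
  moreover have "?h \<in> Pos"
    using d by (rule first_return_closed[rotated]) (use bij_travel in \<open>auto simp: bij_betw_def\<close>)
  ultimately show "next_arc_end P x \<in> arc_ends P" "departure P (next_arc_end P x) = ?h"
    unfolding next_arc_end_def by (rule departure_arc_end_of)+
qed

lemma state_partner_unspliced:
  assumes z: "z \<in> X" and F: "\<And>x. x \<in> F \<Longrightarrow> z \<notin> set (crossing_halves x)"
  shows "partner (state_joins P F) z = A_partner z"
proof -
  have *: "(u, v) \<in> set (state_joins P F)"
    if uv: "(u, v) \<in> set (all_A_joins P)" and "z = u \<or> z = v" for u v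
  proof -
    from uv consider x where "x \<in> set (crossings P)" "(u, v) \<in> set (A_splice x)"
      | "(u, v) \<in> set (joins P)"
      unfolding all_A_joins_eq set_state_joins_iff by auto
    then show ?thesis
    proof cases
      case 1
      obtain p q r t where "x = (p, q, r, t)" by (cases x)
      with 1 that(2) have "z \<in> set (crossing_halves x)" by auto
      then have "x \<notin> F" using F by blast
      with 1 show ?thesis unfolding set_state_joins_iff by (auto intro!: bexI[of _ x])
    qed (simp add: set_state_joins_iff)
  qed
  show ?thesis
    using A_partner_props(4)[OF z] *[of z "A_partner z"] *[of "A_partner z" z]
      partner_of_join[OF distinct_state_joins] by blast
qed

text \<open>
  Who arrives at one end of a B-spliced arc departs from its other end: the walk along a circle of
  the state turns into the side of the band.
\<close>

lemma state_partner_spliced: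
  assumes F: "F \<subseteq> set (crossings P)" and x: "x \<in> F \<times> UNIV"
  shows "partner (state_joins P F) (A_partner (departure P x)) = departure P (other_end x)"
proof -
  obtain a b c d t where x': "x = ((a, b, c, d), t)" by (cases x) auto
  then have mem: "(a, b, c, d) \<in> F" and c: "(a, b, c, d) \<in> set (crossings P)" using F x by auto
  have "(b, c) \<in> set (state_joins P F)" "(d, a) \<in> set (state_joins P F)"
    unfolding set_state_joins_iff using mem c by (force intro: bexI[OF _ c])+
  note p = this[THEN partner_of_join(1)[OF distinct_state_joins]]
    this[THEN partner_of_join(2)[OF distinct_state_joins]]
  show ?thesis
    unfolding x' by (cases t; cases "a \<in> Pos")
      (simp_all add: departure_crossing[OF c] A_partner_crossing[OF c] p)
qed

text \<open>
  A circle of the state with B-splicings at \<open>F\<close> follows the circles of the all-A state from arc-end to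
  arc-end of \<open>F\<close> and hops to the other end of the arc each time; a boundary component of the ribbon
  surface does the same.  Circles without arc-ends of \<open>F\<close> are the isolated vertices.
\<close>

lemma num_faces_spanning_subdessin:
  assumes F: "F \<subseteq> set (crossings P)"
  shows "num_faces (spanning_subdessin (all_A_dessin P) F) = card (circles op (state_joins P F))"
proof -
  let ?H = "spanning_subdessin (all_A_dessin P) F"
  let ?E = "F \<times> (UNIV :: bool set)"
  let ?\<tau> = "travel P"
  define S where "S = departure P ` ?E"
  define s where "s h = departure P (other_end (arc_end_of P h))" for h
  define G where "G h = s (first_return ?\<tau> S h)" for h
  define N where "N = first_return (next_arc_end P) ?E"
  have E: "?E \<subseteq> arc_ends P" using F by (auto simp: arc_ends_def)
  have other_E: "other_end x \<in> ?E \<longleftrightarrow> x \<in> ?E" for x :: "'h crossing \<times> bool"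
    by (cases x) simp
  have s_dep: "s (departure P x) = departure P (other_end x)" if "x \<in> arc_ends P" for x
    using that by (simp add: s_def arc_end_of_departure)
  have SPos: "S \<subseteq> Pos" unfolding S_def using E departure_props(2) by blast
  have SCH: "S \<subseteq> crossing_half_set P"
    unfolding S_def using E departure_in_crossing_half_set by blast
  have dep_S: "departure P x \<in> S \<longleftrightarrow> x \<in> ?E" if "x \<in> arc_ends P" for x
    unfolding S_def using E that by (intro inj_on_image_mem_iff[OF inj_departure])
  have "bij_betw s S S"
  proof (rule bij_betw_byWitness[where f' = s])
    have "s (s h) = h \<and> s h \<in> S" if "h \<in> S" for h
    proof -
      obtain x where "x \<in> ?E" "h = departure P x" using \<open>h \<in> S\<close> unfolding S_def by blast
      moreover from this have "other_end x \<in> ?E" by (simp only: other_E)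
      ultimately show ?thesis using E s_dep dep_S by (metis other_end_other_end subsetD)
    qed
    then show "\<forall>h\<in>S. s (s h) = h" "\<forall>h\<in>S. s (s h) = h" "s ` S \<subseteq> S" "s ` S \<subseteq> S" by blast+
  qed
  moreover have "state_travel F h = (if ?\<tau> h \<in> S then s (?\<tau> h) else ?\<tau> h)" if h: "h \<in> Pos" for h
  proof -
    have z: "?\<tau> h \<in> Pos" using bij_travel h by (auto simp: bij_betw_def)
    then have zX: "?\<tau> h \<in> X" using Pos_subset by blast
    have "h \<in> X" using h Pos_subset by blast
    then have oph: "op h = A_partner (?\<tau> h)"
      by (simp add: travel_def A_partner_props op_props)
    show ?thesis
    proof (cases "?\<tau> h \<in> S")
      case True
      then obtain x where x: "x \<in> ?E" "?\<tau> h = departure P x" unfolding S_def by blast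
      have "state_travel F h = departure P (other_end x)"
        unfolding state_travel_def oph x(2) using F x(1) by (rule state_partner_spliced)
      also have "\<dots> = s (?\<tau> h)" using s_dep[of x] x E by auto
      finally show ?thesis using True by simp
    next
      case False
      have "?\<tau> h \<notin> set (crossing_halves x)" if "x \<in> F" for x
      proof
        assume "?\<tau> h \<in> set (crossing_halves x)"
        then have "?\<tau> h \<in> arc_end_halves (x, True) \<or> ?\<tau> h \<in> arc_end_halves (x, False)"
          by (cases x) auto
        then obtain t where t: "?\<tau> h \<in> arc_end_halves (x, t)" by blast
        have "(x, t) \<in> ?E" using \<open>x \<in> F\<close> by simp
        moreover from this E t z have "?\<tau> h = departure P (x, t)"
          by (intro departure_props(3)) blast+
        ultimately show False using False unfolding S_def by blast
      qed
      with zX have "partner (state_joins P F) (?\<tau> h) = A_partner (?\<tau> h)"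
        by (rule state_partner_unspliced)
      then have "state_travel F h = ?\<tau> h"
        unfolding state_travel_def oph using state_partner(3)[OF zX, of F] by simp
      with False show ?thesis by simp
    qed
  qed
  ultimately have "card (orbit (state_travel F) ` Pos) =
      card (orbit (\<lambda>h. s (first_return ?\<tau> S h)) ` S) + card (orbit ?\<tau> ` {h \<in> Pos. orbit ?\<tau> h \<inter> S = {}})"
    by (rule card_orbits_switched[OF finite_Pos bij_travel SPos])
  then have card: "card (circles op (state_joins P F)) =
      card (orbit G ` S) + card (orbit ?\<tau> ` {h \<in> Pos. orbit ?\<tau> h \<inter> S = {}})"
    unfolding G_def[abs_def] state_circles(3) .

  have N: "N x \<in> ?E \<and> departure P (N x) = first_return ?\<tau> S (departure P x)" if x: "x \<in> ?E" for x
  proof -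
    have xA: "x \<in> arc_ends P" using x E by blast
    have dS: "departure P x \<in> S" using x unfolding S_def by blast
    have meet: "orbit ?\<tau> (departure P x) \<inter> S \<noteq> {}"
      using dS SPos self_in_orbit_bij[OF finite_Pos bij_travel] by blast
    have "departure P (N x) =
        first_return (first_return ?\<tau> (crossing_half_set P)) S (departure P x)"
      unfolding N_def
      by (rule first_return_semiconj[where A = "arc_ends P"])
         (use next_arc_end_props dep_S xA in auto)
    also have "\<dots> = first_return ?\<tau> S (departure P x)"
      using meet SCH by (rule first_return_first_return)
    finally have eq: "departure P (N x) = first_return ?\<tau> S (departure P x)" .
    have "N x \<in> arc_ends P"
      unfolding N_def using next_arc_end_props(1) xA by (rule first_return_closed)
    moreover have "departure P (N x) \<in> S" unfolding eq using first_return_in[OF meet] by blast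
    ultimately show ?thesis using eq dep_S by blast
  qed
  have step: "face_step ?H x = N (other_end x)" for x
    by (cases x) (simp add: face_step_def spanning_subdessin_def all_A_dessin_def N_def)
  have step_E: "face_step ?H x \<in> ?E" if "x \<in> ?E" for x
    unfolding step using that N other_E by blast
  \<comment> \<open>A step of a face hops first and turns afterwards, whereas the return map of the walk turns
    first; going to the other end once translates between the two.\<close>
  let ?\<psi> = "\<lambda>x. departure P (other_end x)"
  have conj: "?\<psi> (face_step ?H x) = G (?\<psi> x)" if "x \<in> ?E" for x
  proof -
    have "other_end x \<in> ?E" using that by (simp only: other_E)
    note n = N[OF this]
    have "N (other_end x) \<in> arc_ends P" using E conjunct1[OF n] by (rule subsetD)
    from s_dep[OF this] n show ?thesis unfolding step G_def by simp
  qed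
  have inj: "inj_on ?\<psi> ?E"
  proof (rule inj_onI)
    fix x y assume "x \<in> ?E" "y \<in> ?E" "?\<psi> x = ?\<psi> y"
    moreover from this have "other_end x \<in> arc_ends P" "other_end y \<in> arc_ends P"
      using E other_E by blast+
    ultimately have "other_end x = other_end y"
      using inj_departure by (auto dest: inj_onD)
    then show "x = y" by (metis other_end_other_end)
  qed
  have "?\<psi> ` ?E = S"
    unfolding S_def using other_E other_end_other_end by (smt (verit) image_iff subsetI subset_antisym)
  then have "orbit G ` S = (\<lambda>x. orbit G (?\<psi> x)) ` ?E" by (metis image_image)
  also have "\<dots> = (\<lambda>x. ?\<psi> ` orbit (face_step ?H) x) ` ?E"
    by (rule image_cong[OF refl], rule orbit_semiconj[of ?E]) (use step_E conj in blast)+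
  also have "card \<dots> = card (orbit (face_step ?H) ` ?E)"
  proof (rule card_image_eq_if_same_kernel)
    fix x y assume "x \<in> ?E" "y \<in> ?E"
    then have "orbit (face_step ?H) x \<subseteq> ?E" "orbit (face_step ?H) y \<subseteq> ?E"
      using orbit_closed[of ?E "face_step ?H"] step_E by blast+
    then show "?\<psi> ` orbit (face_step ?H) x = ?\<psi> ` orbit (face_step ?H) y \<longleftrightarrow>
        orbit (face_step ?H) x = orbit (face_step ?H) y"
      by (rule inj_on_image_eq_iff[OF inj])
  qed
  finally have cycles: "card (orbit G ` S) = card (orbit (face_step ?H) ` edge_ends ?H)"
    by (simp add: edge_ends_def spanning_subdessin_def)

  have meets: "orbit ?\<tau> h \<inter> S = {} \<longleftrightarrow> A_circle_of P h \<notin> arc_end_circle P ` ?E" if h: "h \<in> Pos" for h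
  proof -
    have "departure P x \<in> orbit ?\<tau> h \<longleftrightarrow> A_circle_of P h = arc_end_circle P x" if "x \<in> ?E" for x
    proof -
      have xA: "x \<in> arc_ends P" using that E by blast
      note d = departure_props(2)[OF xA]
      show ?thesis
        unfolding arc_end_circle_eq[OF xA] A_circle_of_eq_iff_orbit[OF h d]
        using orbit_eq_iff_bij[OF finite_Pos bij_travel h d] by blast
    qed
    then show ?thesis unfolding S_def by blast
  qed
  have "isolated_verts ?H = A_circle_of P ` {h \<in> Pos. orbit ?\<tau> h \<inter> S = {}}"
  proof (intro equalityI subsetI)
    fix C assume "C \<in> isolated_verts ?H"
    then have C: "C \<in> A_circles P" "C \<notin> arc_end_circle P ` ?E"
      by (auto simp: isolated_verts_def edge_ends_def spanning_subdessin_def all_A_dessin_def)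
    then obtain h where "h \<in> X" "C = A_circle_of P h" by (auto simp: A_circles_eq)
    then obtain k where k: "k \<in> Pos" "C = A_circle_of P k"
      using Pos_op[of h] A_circle_of_op[of h] by (cases "h \<in> Pos") auto
    with C meets[OF k(1)] show "C \<in> A_circle_of P ` {h \<in> Pos. orbit ?\<tau> h \<inter> S = {}}"
      by blast
  next
    fix C assume "C \<in> A_circle_of P ` {h \<in> Pos. orbit ?\<tau> h \<inter> S = {}}"
    then obtain k where "k \<in> Pos" "C = A_circle_of P k" "C \<notin> arc_end_circle P ` ?E"
      using meets by blast
    then show "C \<in> isolated_verts ?H"
      using Pos_subset A_circle_of_in
      by (auto simp: isolated_verts_def edge_ends_def spanning_subdessin_def all_A_dessin_def)
  qed
  moreover have "card (A_circle_of P ` {h \<in> Pos. orbit ?\<tau> h \<inter> S = {}}) =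
      card (orbit ?\<tau> ` {h \<in> Pos. orbit ?\<tau> h \<inter> S = {}})"
    by (rule card_image_eq_if_same_kernel) (simp add: A_circle_of_eq_iff_orbit)
  ultimately show ?thesis
    unfolding num_faces_def card cycles by simp
qed

end

section \<open>The bracket as a sum over states\<close>

lemma A_power_mult: "A_power i * A_power j = A_power (i + j)"
  by (simp add: A_power_def mult_single)

lemma circles_cong: "set js = set js' \<Longrightarrow> circles op js = circles op js'"
  by (simp add: circles_def circle_rel_def set_join_halves)

text \<open>
  All crossings are resolved; \<open>F\<close> is the set of those with the B-splicing.
\<close>

lemma bracket_expansion:
  assumes "distinct cs"
  shows "bracket op js cs = (\<Sum>F\<in>Pow (set cs). A_power (int (length cs) - 2 * int (card F)) *
           circle_value ^ (card (circles op
             (concat (map (\<lambda>x. if x \<in> F then B_splice x else A_splice x) cs) @ js)) - 1))"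
    (is "_ = (\<Sum>F\<in>_. ?t cs js F)")
  using assms
proof (induction cs arbitrary: js)
  case (Cons x xs)
  let ?P = "Pow (set xs)"
  have x: "x \<notin> F" and fin: "finite F" if "F \<in> ?P" for F
    using that Cons.prems finite_subset by auto
  have A: "?t (x # xs) js F = A_power 1 * ?t xs (A_splice x @ js) F" if F: "F \<in> ?P" for F
  proof -
    have "circles op (concat (map (\<lambda>x. if x \<in> F then B_splice x else A_splice x) (x # xs)) @ js) =
        circles op (concat (map (\<lambda>x. if x \<in> F then B_splice x else A_splice x) xs) @ A_splice x @ js)"
      using x[OF F] by (intro circles_cong) auto
    then show ?thesis
      by (simp add: mult.assoc[symmetric] A_power_mult algebra_simps)
  qed
  have B: "?t (x # xs) js (insert x F) = A_power (- 1) * ?t xs (B_splice x @ js) F" if F: "F \<in> ?P" for F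
  proof -
    have "map (\<lambda>y. if y \<in> insert x F then B_splice y else A_splice y) xs =
        map (\<lambda>y. if y \<in> F then B_splice y else A_splice y) xs"
      using Cons.prems by (intro map_cong) auto
    then have "circles op (concat (map (\<lambda>y. if y \<in> insert x F then B_splice y else A_splice y) (x # xs)) @ js) =
        circles op (concat (map (\<lambda>y. if y \<in> F then B_splice y else A_splice y) xs) @ B_splice x @ js)"
      by (intro circles_cong) auto
    then show ?thesis
      using x[OF F] fin[OF F] by (simp add: mult.assoc[symmetric] A_power_mult algebra_simps)
  qed
  have "inj_on (insert x) ?P"
    using x by (intro inj_onI) (metis insert_ident)
  moreover have "?P \<inter> insert x ` ?P = {}"
    using x by blast
  ultimately have "(\<Sum>F\<in>Pow (set (x # xs)). ?t (x # xs) js F) =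
      (\<Sum>F\<in>?P. ?t (x # xs) js F) + (\<Sum>F\<in>?P. ?t (x # xs) js (insert x F))"
    by (simp add: Pow_insert sum.union_disjoint sum.reindex)
  also have "\<dots> = (\<Sum>F\<in>?P. A_power 1 * ?t xs (A_splice x @ js) F) +
      (\<Sum>F\<in>?P. A_power (- 1) * ?t xs (B_splice x @ js) F)"
    using A B by (intro arg_cong2[where f = "(+)"] sum.cong refl) blast+
  also have "\<dots> = bracket op js (x # xs)"
    using Cons.prems by (simp add: Cons.IH sum_distrib_left)
  finally show ?case ..
qed (simp add: A_power_def)

lemma coefficient_A_power_mult: "coefficient (A_power i * p) k = coefficient p (k - i)"
proof (induction p rule: frag_induction[OF subset_UNIV, case_names zero one diff])
  case (one j)
  show ?case
    by (simp add: A_power_def mult_single lookup_single when_def algebra_simps)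
qed (simp_all add: right_diff_distrib lookup_minus)

lemma coefficient_circle_value_mult:
  "coefficient (circle_value * p) k = - coefficient p (k - 2) - coefficient p (k + 2)"
  by (simp add: circle_value_def left_diff_distrib lookup_minus coefficient_A_power_mult)

lemma coefficient_circle_value_power:
  shows "k > 2 * int n \<Longrightarrow> coefficient (circle_value ^ n) k = 0"
    and "coefficient (circle_value ^ n) (2 * int n) = (- 1) ^ n"
proof -
  have *: "coefficient (circle_value ^ n) k = 0" if "k > 2 * int n" for n k
    using that
  proof (induction n arbitrary: k)
    case 0
    then show ?case by (simp add: lookup_one)
  next
    case (Suc n)
    then show ?case by (simp add: coefficient_circle_value_mult)
  qed
  then show "k > 2 * int n \<Longrightarrow> coefficient (circle_value ^ n) k = 0" .
  show "coefficient (circle_value ^ n) (2 * int n) = (- 1) ^ n"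
    by (induction n) (simp_all add: coefficient_circle_value_mult * lookup_one)
qed

section \<open>The genus of sub-dessins\<close>

text \<open>
  The edges \<open>(a, b)\<close> and \<open>(c, d)\<close> of one splicing are replaced by \<open>(b, c)\<close> and \<open>(d, a)\<close>.  Two edges merge
  at most two pairs of classes.  If the count went up by two, then the new edges would merge
  nothing; but with \<open>b\<close> connected to \<open>c\<close> and \<open>d\<close> to \<open>a\<close> the second of the old edges merges nothing
  either.
\<close>

lemma card_classes_resplice_le:
  assumes "finite V" and "a \<in> V" and "b \<in> V" and "c \<in> V" and "d \<in> V"
  shows "card (V // equiv_closure (insert (b, c) (insert (d, a) R))) \<le>
           card (V // equiv_closure (insert (a, b) (insert (c, d) R))) + 1"
proof (rule ccontr)
  assume less: "\<not> ?thesis"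
  note n = card_classes_insert[OF assms(1)]
  note B = n[OF assms(3,4), of "insert (d, a) R"] n[OF assms(5,2), of R]
  note A = n[OF assms(2,3), of "insert (c, d) R"] n[OF assms(4,5), of R]
  have da: "(d, a) \<in> equiv_closure R" and bc: "(b, c) \<in> equiv_closure (insert (d, a) R)"
    and ab: "(a, b) \<notin> equiv_closure (insert (c, d) R)"
    using less A B by (auto split: if_splits)
  have "insert (d, a) R \<subseteq> equiv_closure R"
    using da by (auto intro: equiv_closure_base)
  from equiv_closure_mono[OF bc this] have "(b, c) \<in> equiv_closure (insert (c, d) R)"
    by (rule equiv_closure_insert)
  also have "(c, d) \<in> equiv_closure (insert (c, d) R)"
    by (simp add: equiv_closure_base)
  also (equiv_closure_trans) have "(d, a) \<in> equiv_closure (insert (c, d) R)"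
    using da by (rule equiv_closure_insert)
  finally (equiv_closure_trans) show False
    using ab equiv_closure_sym[of b a] by blast
qed

text \<open>
  If the two strands at a crossing are closed up separately, then the other splicing merges the
  circles.
\<close>

lemma card_classes_resplice_less:
  assumes "finite V" and "a \<in> V" and "b \<in> V" and "c \<in> V" and "d \<in> V"
    and ab: "(a, b) \<in> equiv_closure R" and cd: "(c, d) \<in> equiv_closure R"
    and ac: "(a, c) \<notin> equiv_closure R"
  shows "card (V // equiv_closure (insert (b, c) (insert (d, a) R))) <
           card (V // equiv_closure (insert (a, b) (insert (c, d) R)))"
proof -
  note n = card_classes_insert[OF assms(1)]
  have "(d, a) \<notin> equiv_closure R"
    using ac cd by (meson equiv_closure_sym equiv_closure_trans)
  moreover have "(a, b) \<in> equiv_closure (insert (c, d) R)"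
    using ab by (rule equiv_closure_insert)
  ultimately show ?thesis
    using n[OF assms(3,4), of "insert (d, a) R"] n[OF assms(5,2), of R]
      n[OF assms(2,3), of "insert (c, d) R"] n[OF assms(4,5), of R] cd
    by simp
qed

text \<open>
  A circle stays connected when one join is removed.  If \<open>b\<close> were not in the class \<open>K\<close> of \<open>a\<close>, then the
  involution \<open>op\<close> would show that \<open>K\<close> has even size, and \<open>partner\<close> that \<open>K\<close> without \<open>a\<close> has even size.
  The pairs of \<open>js\<close> that are missing from \<open>R\<close> may include a second join far from \<open>a\<close>, such as
  the other half of a splice.
\<close>

lemma connected_without_join:
  assumes dist: "distinct (join_halves js)" and ab: "(a, b) \<in> set js"
    and op: "\<And>h. h \<in> set (join_halves js) \<Longrightarrow>
      op h \<in> set (join_halves js) \<and> op h \<noteq> h \<and> op (op h) = h \<and> (h, op h) \<in> R"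
    and js: "\<And>u v. (u, v) \<in> set js \<Longrightarrow>
      (u, v) \<in> R \<or> (u, v) = (a, b) \<or> (a, u) \<notin> equiv_closure R \<and> (a, v) \<notin> equiv_closure R"
  shows "(a, b) \<in> equiv_closure R"
proof (rule ccontr)
  assume contra: "(a, b) \<notin> equiv_closure R"
  let ?X = "set (join_halves js)"
  define K where "K = {h \<in> ?X. (a, h) \<in> equiv_closure R}"
  note pp = partner_props[OF dist] and pab = partner_of_join[OF dist ab]
  have fin: "finite K" by (simp add: K_def)
  have "even (card K)"
  proof (rule even_card_fixpoint_free_involution[OF fin, where f = op])
    fix h assume "h \<in> K"
    then have h: "h \<in> ?X" "(a, h) \<in> equiv_closure R" by (simp_all add: K_def)
    then have "(a, op h) \<in> equiv_closure R"
      using op[OF h(1)] equiv_closure_trans equiv_closure_base by metis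
    with op[OF h(1)] show "op h \<in> K \<and> op h \<noteq> h \<and> op (op h) = h"
      by (simp add: K_def)
  qed
  moreover have "even (card (K - {a}))"
  proof (rule even_card_fixpoint_free_involution[where f = "partner js"])
    fix h assume "h \<in> K - {a}"
    then have h: "h \<in> ?X" "(a, h) \<in> equiv_closure R" "h \<noteq> a" by (simp_all add: K_def)
    have "h \<noteq> b" using h contra by blast
    have "(h, partner js h) \<in> equiv_closure R"
      using pp(4)[OF h(1)]
    proof
      assume "(h, partner js h) \<in> set js"
      with js[OF this] h show ?thesis by (auto intro: equiv_closure_base)
    next
      assume *: "(partner js h, h) \<in> set js"
      with js[OF this] h \<open>h \<noteq> b\<close> show ?thesis
        by (auto intro: equiv_closure_sym[OF equiv_closure_base])
    qed
    with h have "(a, partner js h) \<in> equiv_closure R"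
      by (blast intro: equiv_closure_trans)
    moreover have "partner js h \<noteq> a"
    proof
      assume "partner js h = a"
      then have "partner js a = h" using pp(3)[OF h(1)] by simp
      with pab(1) \<open>h \<noteq> b\<close> show False by simp
    qed
    ultimately show "partner js h \<in> K - {a} \<and> partner js h \<noteq> h \<and> partner js (partner js h) = h"
      using pp(1-3)[OF h(1)] by (simp add: K_def)
  qed (use fin in simp)
  moreover have "a \<in> K"
    using ab by (force simp: K_def set_join_halves)
  ultimately show False
    using fin by (metis card_Suc_Diff1 even_Suc)
qed

context plane_diagram
begin

abbreviation "sub F \<equiv> spanning_subdessin (all_A_dessin P) F"

lemma num_verts_sub: "num_verts (sub F) = card (A_circles P)"
  by (simp add: num_verts_def spanning_subdessin_def all_A_dessin_def)

lemma num_verts_D: "num_verts (all_A_dessin P) = card (A_circles P)"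
  by (simp add: num_verts_def all_A_dessin_def)

lemma num_edges_sub: "num_edges (sub F) = card F"
  by (simp add: num_edges_def spanning_subdessin_def)

lemma num_edges_D: "num_edges (all_A_dessin P) = length (crossings P)"
  by (simp add: num_edges_def all_A_dessin_def distinct_card distinct_crossings)

definition ends_adjacency :: "'h crossing set \<Rightarrow> ('h set \<times> 'h set) set" where
  "ends_adjacency F = {(arc_end_circle P (e, True), arc_end_circle P (e, False)) | e. e \<in> F}"

lemma num_components_sub:
  "num_components (sub F) = card (A_circles P // equiv_closure (ends_adjacency F))"
  by (simp add: num_components_def adjacency_def spanning_subdessin_def all_A_dessin_def
      ends_adjacency_def)

lemma finite_A_circles: "finite (A_circles P)"
  by (simp add: A_circles_eq finite_X)

lemma num_components_le: "num_components (sub F) \<le> card (A_circles P)"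
  unfolding num_components_sub quotient_eq_image by (rule card_image_le[OF finite_A_circles])

lemma arc_end_circle_crossing:
  assumes x: "(a, b, c, d) \<in> set (crossings P)"
  shows "arc_end_circle P ((a, b, c, d), True) = A_circle_of P a"
    and "arc_end_circle P ((a, b, c, d), False) = A_circle_of P c"
    and "A_circle_of P b = A_circle_of P a" and "A_circle_of P d = A_circle_of P c"
proof -
  note X = crossing_distinct[OF x]
  show "A_circle_of P b = A_circle_of P a" "A_circle_of P d = A_circle_of P c"
    using A_circle_of_partner[of a] A_circle_of_partner[of c] X A_partner_crossing[OF x] by simp_all
  then show "arc_end_circle P ((a, b, c, d), True) = A_circle_of P a"
    "arc_end_circle P ((a, b, c, d), False) = A_circle_of P c"
    using x by (simp_all add: arc_end_circle_eq arc_ends_def departure_crossing)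
qed

lemma arc_end_circle_in: "x \<in> set (crossings P) \<Longrightarrow> arc_end_circle P (x, t) \<in> A_circles P"
  using arc_end_circle_eq[of "(x, t)"] departure_props(2)[of "(x, t)"] A_circle_of_in Pos_subset
  by (auto simp: arc_ends_def)

text \<open>
  A circle of the state runs along all-A circles and along bands of \<open>F\<close>.
\<close>

lemma state_circle_in_component:
  assumes "(u, v) \<in> circle_rel op (state_joins P F)"
  shows "(A_circle_of P u, A_circle_of P v) \<in> equiv_closure (ends_adjacency F)"
  using assms unfolding circle_rel_def
proof (rule equiv_closure_map)
  fix u v
  assume "(u, v) \<in> set (state_joins P F) \<union> {(h, op h) | h. h \<in> set (join_halves (state_joins P F))}"
  then consider x where "x \<in> set (crossings P)" "(u, v) \<in> set (if x \<in> F then B_splice x else A_splice x)"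
    | "(u, v) \<in> set (joins P)" | "u \<in> X" "v = op u"
    unfolding set_state_joins Un_iff set_state_joins_iff by blast
  then show "(A_circle_of P u, A_circle_of P v) \<in> equiv_closure (ends_adjacency F)"
  proof cases
    case 1
    obtain a b c d where x: "x = (a, b, c, d)" by (cases x)
    note e = arc_end_circle_crossing[OF 1(1)[unfolded x]]
    show ?thesis
    proof (cases "x \<in> F")
      case True
      then have "(A_circle_of P a, A_circle_of P c) \<in> equiv_closure (ends_adjacency F)"
        unfolding e(1,2)[symmetric] x[symmetric] ends_adjacency_def
        by (intro equiv_closure_base) blast
      moreover from True 1(2) have "(u, v) = (b, c) \<or> (u, v) = (d, a)" by (simp add: x)
      ultimately show ?thesis
        using equiv_closure_sym e(3,4) by auto
    next
      case False
      with 1(2) have "(u, v) = (a, b) \<or> (u, v) = (c, d)" by (simp add: x)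
      then have "A_circle_of P u = A_circle_of P v" using e(3,4) by auto
      then show ?thesis by simp
    qed
  next
    case 2
    then have "u \<in> X" unfolding X_eq by (auto intro!: bexI[OF _ join_vertex_list[OF 2]])
    then show ?thesis using A_circle_of_partner[of u] A_partner_join[OF 2] by simp
  next
    case 3
    then show ?thesis by (simp add: A_circle_of_op)
  qed
qed

lemma num_faces_sub_empty: "num_faces (sub {}) = card (A_circles P)"
  using num_faces_spanning_subdessin[of "{}"] by (simp add: A_circles_def all_A_joins_eq)

lemma num_components_sub_empty: "num_components (sub {}) = card (A_circles P)"
  unfolding num_components_sub quotient_eq_image
  by (simp add: ends_adjacency_def equiv_closure_empty card_image)

text \<open>
  The genus of a sub-dessin is not negative.  Starting from isolated vertices, edges are added one by
  one.  Each changes the number of faces by at most one; if it connects two components, then its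
  ends are on different circles of the state, these are merged, and the number of faces drops
  together with the number of components.
\<close>

lemma genus_bound:
  assumes "F \<subseteq> set (crossings P)"
  shows "num_faces (sub F) + card (A_circles P) \<le> 2 * num_components (sub F) + card F"
proof -
  have "finite F" using assms finite_subset by blast
  then show ?thesis using assms
  proof (induction F)
    case empty
    show ?case by (simp add: num_faces_sub_empty num_components_sub_empty)
  next
    case (insert x F)
    obtain a b c d where x: "x = (a, b, c, d)" by (cases x)
    have mem: "(a, b, c, d) \<in> set (crossings P)" and F: "F \<subseteq> set (crossings P)"
      using insert.prems x by auto
    note X = crossing_distinct[OF mem]
    define T where "T = (\<Union>y\<in>set (crossings P) - {x}. set (if y \<in> F then B_splice y else A_splice y))
      \<union> set (joins P)"
    define R where "R = T \<union> {(h, op h) | h. h \<in> X}"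
    have cs: "set (crossings P) = insert x (set (crossings P) - {x})"
      using mem x by blast
    have st: "set (state_joins P F') =
        (\<Union>y\<in>insert x (set (crossings P) - {x}). set (if y \<in> F' then B_splice y else A_splice y))
        \<union> set (joins P)" for F'
      unfolding cs[symmetric]
      by (simp only: state_joins_def set_append set_concat set_map image_image)
    have mem_A: "set (state_joins P F) = insert (a, b) (insert (c, d) T)"
      unfolding st UN_insert T_def using insert.hyps(2) by (simp add: x)
    have "(\<Union>y\<in>set (crossings P) - {x}. set (if y \<in> insert x F then B_splice y else A_splice y)) =
        (\<Union>y\<in>set (crossings P) - {x}. set (if y \<in> F then B_splice y else A_splice y))"
      by (rule SUP_cong[OF refl]) simp
    then have mem_B: "set (state_joins P (insert x F)) = insert (b, c) (insert (d, a) T)"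
      unfolding st UN_insert T_def by (simp add: x)
    have A: "circle_rel op (state_joins P F) = equiv_closure (insert (a, b) (insert (c, d) R))"
      unfolding circle_rel_def set_state_joins R_def mem_A by (simp only: Un_insert_left)
    have B: "circle_rel op (state_joins P (insert x F)) =
        equiv_closure (insert (b, c) (insert (d, a) R))"
      unfolding circle_rel_def set_state_joins R_def mem_B by (simp only: Un_insert_left)
    let ?f = "card (circles op (state_joins P F))"
    let ?f' = "card (circles op (state_joins P (insert x F)))"
    have f: "num_faces (sub F) = ?f" "num_faces (sub (insert x F)) = ?f'"
      using num_faces_spanning_subdessin F insert.prems by blast+
    have le: "?f' \<le> ?f + 1"
      unfolding circles_def set_state_joins A B
      using finite_X X(2-5) by (rule card_classes_resplice_le)
    have "ends_adjacency (insert x F) =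
        insert (arc_end_circle P (x, True), arc_end_circle P (x, False)) (ends_adjacency F)"
      unfolding ends_adjacency_def by blast
    then have adj: "ends_adjacency (insert x F) = insert (A_circle_of P a, A_circle_of P c) (ends_adjacency F)"
      unfolding x arc_end_circle_crossing(1,2)[OF mem] .
    have k: "num_components (sub F) = num_components (sub (insert x F)) +
        (if (A_circle_of P a, A_circle_of P c) \<in> equiv_closure (ends_adjacency F) then 0 else 1)"
      unfolding num_components_sub adj
      using finite_A_circles A_circle_of_in[OF X(2)] A_circle_of_in[OF X(4)] by (rule card_classes_insert)
    have IH: "num_faces (sub F) + card (A_circles P) \<le> 2 * num_components (sub F) + card F"
      using insert.IH F by blast
    show ?case
    proof (cases "(A_circle_of P a, A_circle_of P c) \<in> equiv_closure (ends_adjacency F)")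
      case True
      then show ?thesis using IH k le f insert.hyps by simp
    next
      case False
      then have nA: "(a, c) \<notin> circle_rel op (state_joins P F)"
        using state_circle_in_component[of a c F] by blast
      have R_A: "equiv_closure R \<subseteq> circle_rel op (state_joins P F)"
        unfolding A by (intro subrelI equiv_closure_insert)
      have tr: "(u, w) \<in> circle_rel op (state_joins P F)"
        if "(u, v) \<in> circle_rel op (state_joins P F)" "(v, w) \<in> circle_rel op (state_joins P F)" for u v w
        using that unfolding circle_rel_def by (rule equiv_closure_trans)
      have sy: "(v, u) \<in> circle_rel op (state_joins P F)"
        if "(u, v) \<in> circle_rel op (state_joins P F)" for u v
        using that unfolding circle_rel_def by (rule equiv_closure_sym)
      have ab: "(a, b) \<in> circle_rel op (state_joins P F)" "(c, d) \<in> circle_rel op (state_joins P F)"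
        unfolding A by (auto intro: equiv_closure_base)
      have nR: "(a, c) \<notin> equiv_closure R" "(a, d) \<notin> equiv_closure R"
        "(c, a) \<notin> equiv_closure R" "(c, b) \<notin> equiv_closure R"
        using nA R_A sy[of c a] tr[of a d c] sy[OF ab(2)] tr[of c b a] sy[OF ab(1)] by blast+
      have opR: "op h \<in> X \<and> op h \<noteq> h \<and> op (op h) = h \<and> (h, op h) \<in> R" if "h \<in> X" for h
        using op_props[OF that] that by (simp add: R_def)
      have jR: "(u, v) \<in> R \<or> (u, v) = (a, b) \<or> (u, v) = (c, d)" if "(u, v) \<in> set (state_joins P F)" for u v
        using that unfolding mem_A R_def by blast
      have "(a, b) \<in> equiv_closure R"
      proof (rule connected_without_join[OF distinct_state_joins[of F]])
        show "(a, b) \<in> set (state_joins P F)" by (simp add: mem_A)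
        show "op h \<in> set (join_halves (state_joins P F)) \<and> op h \<noteq> h \<and> op (op h) = h \<and> (h, op h) \<in> R"
          if "h \<in> set (join_halves (state_joins P F))" for h
          using that opR unfolding set_state_joins by blast
        show "(u, v) \<in> R \<or> (u, v) = (a, b) \<or> (a, u) \<notin> equiv_closure R \<and> (a, v) \<notin> equiv_closure R"
          if "(u, v) \<in> set (state_joins P F)" for u v
          using jR[OF that] nR by blast
      qed
      moreover have "(c, d) \<in> equiv_closure R"
      proof (rule connected_without_join[OF distinct_state_joins[of F]])
        show "(c, d) \<in> set (state_joins P F)" by (simp add: mem_A)
        show "op h \<in> set (join_halves (state_joins P F)) \<and> op h \<noteq> h \<and> op (op h) = h \<and> (h, op h) \<in> R"
          if "h \<in> set (join_halves (state_joins P F))" for h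
          using that opR unfolding set_state_joins by blast
        show "(u, v) \<in> R \<or> (u, v) = (c, d) \<or> (c, u) \<notin> equiv_closure R \<and> (c, v) \<notin> equiv_closure R"
          if "(u, v) \<in> set (state_joins P F)" for u v
          using jR[OF that] nR by blast
      qed
      ultimately have "?f' < ?f"
        unfolding circles_def set_state_joins A B
        using finite_X X(2-5) nR(1) by (intro card_classes_resplice_less)
      then show ?thesis using IH k f insert.hyps False by simp
    qed
  qed
qed

lemma num_components_less_if_no_loop:
  assumes "\<not> has_loop (all_A_dessin P)" and "F \<subseteq> set (crossings P)" and "F \<noteq> {}"
  shows "num_components (sub F) < card (A_circles P)"
proof -
  obtain e where e: "e \<in> F" using assms(3) by blast
  let ?u = "arc_end_circle P (e, True)" and ?w = "arc_end_circle P (e, False)"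
  let ?cl = "\<lambda>C. equiv_closure (ends_adjacency F) `` {C}"
  have ne: "?u \<noteq> ?w"
    using assms(1,2) e by (auto simp: has_loop_def all_A_dessin_def)
  have "?u \<in> A_circles P" "?w \<in> A_circles P"
    using arc_end_circle_in e assms(2) by blast+
  moreover have "(?u, ?w) \<in> equiv_closure (ends_adjacency F)"
    using e unfolding ends_adjacency_def by (intro equiv_closure_base) blast
  then have "?cl ?u = ?cl ?w" by (simp only: equiv_closure_class_eq_iff)
  ultimately have "\<not> inj_on ?cl (A_circles P)"
    using ne by (auto dest: inj_onD)
  then have "card (?cl ` A_circles P) \<noteq> card (A_circles P)"
    using finite_A_circles eq_card_imp_inj_on by blast
  with num_components_le[of F] show ?thesis
    unfolding num_components_sub quotient_eq_image by simp
qed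

section \<open>Degrees and leading coefficients\<close>

lemma num_faces_pos: "F \<subseteq> set (crossings P) \<Longrightarrow> num_faces (sub F) > 0"
  using outer_in_X finite_X
  by (auto simp: num_faces_spanning_subdessin circles_def set_state_joins quotient_eq_image card_gt_0_iff)

lemma coefficient_expansion_term:
  "coefficient (expansion_term (all_A_dessin P) (sub F)) (exponent_M (all_A_dessin P) - 4 * int l) =
     coefficient (circle_value ^ (num_faces (sub F) - 1))
       (2 * int (card (A_circles P)) - 2 - 4 * int l + 2 * int (card F))"
  unfolding expansion_term_def coefficient_A_power_mult exponent_M_def
  by (simp add: num_edges_sub num_verts_D algebra_simps)

lemma genus_sub:
  "genus (sub F) = (2 * real (num_components (sub F)) - real (card (A_circles P))
     + real (card F) - real (num_faces (sub F))) / 2"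
  by (simp add: genus_def num_verts_sub num_edges_sub)

text \<open>
  Let $M$ be the exponent \<open>exponent_M\<close>.  Since $f = 2k - v + e - 2g$ for a sub-dessin, its term has degree
  $M - 4g - 4(v - k)$, and $k \<le> v$.
\<close>

lemma coefficient_eq_0_if_genus_gt:
  assumes F: "F \<subseteq> set (crossings P)" and g: "genus (sub F) > real l"
  shows "coefficient (expansion_term (all_A_dessin P) (sub F)) (exponent_M (all_A_dessin P) - 4 * int l) = 0"
  unfolding coefficient_expansion_term
proof (rule coefficient_circle_value_power(1))
  have "2 * real (num_components (sub F)) + real (card F) >
      2 * real l + real (card (A_circles P)) + real (num_faces (sub F))"
    using g unfolding genus_sub by (simp add: field_simps)
  then have "2 * num_components (sub F) + card F > 2 * l + card (A_circles P) + num_faces (sub F)"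
    by linarith
  with num_components_le[of F] num_faces_pos[OF F]
  show "2 * int (num_faces (sub F) - 1) <
      2 * int (card (A_circles P)) - 2 - 4 * int l + 2 * int (card F)"
    by linarith
qed

definition extremal :: "'h crossing set \<Rightarrow> bool" where
  "extremal F \<longleftrightarrow> genus (sub F) = 0 \<and> int (num_components (sub F)) - int (card (A_circles P)) = 0"

text \<open>
  The genus bound gives $f \<le> 2k - v + e \<le> v + e$, and degree $M$ requires $f = v + e$, that is, equality
  in both places.
\<close>

lemma top_coefficient:
  assumes F: "F \<subseteq> set (crossings P)"
  shows "coefficient (expansion_term (all_A_dessin P) (sub F)) (exponent_M (all_A_dessin P)) =
    (if extremal F then (- 1) ^ (card (A_circles P) + card F - 1) else 0)"
proof -
  let ?v = "card (A_circles P)" and ?f = "num_faces (sub F)" and ?k = "num_components (sub F)"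
  note le = genus_bound[OF F] num_components_le[of F] and pos = num_faces_pos[OF F]
  have eq: "coefficient (expansion_term (all_A_dessin P) (sub F)) (exponent_M (all_A_dessin P)) =
      coefficient (circle_value ^ (?f - 1)) (2 * int ?v - 2 + 2 * int (card F))"
    using coefficient_expansion_term[of F 0] by simp
  show ?thesis
  proof (cases "extremal F")
    case True
    then have "?k = ?v" and "2 * real ?k - real ?v + real (card F) - real ?f = 0"
      by (simp_all add: extremal_def genus_sub)
    then have "?f = ?v + card F" by linarith
    moreover from this have "2 * int ?v - 2 + 2 * int (card F) = 2 * int (?f - 1)"
      using pos by linarith
    ultimately show ?thesis
      using True unfolding eq by (simp only: coefficient_circle_value_power(2) if_True)
  next
    case False
    have "?f < ?v + card F"
    proof (rule ccontr)
      assume "\<not> ?thesis"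
      then have "?k = ?v" "?f = ?v + card F" using le by linarith+
      then show False using False by (simp add: extremal_def genus_sub)
    qed
    then have "2 * int (?f - 1) < 2 * int ?v - 2 + 2 * int (card F)" using pos by linarith
    then show ?thesis using False unfolding eq by (simp add: coefficient_circle_value_power(1))
  qed
qed

lemma extremal_empty: "extremal {}"
  by (simp add: extremal_def genus_sub num_faces_sub_empty num_components_sub_empty)

lemma not_extremal_if_no_loop:
  assumes "\<not> has_loop (all_A_dessin P)" and "F \<subseteq> set (crossings P)" and "F \<noteq> {}"
  shows "\<not> extremal F"
  using num_components_less_if_no_loop[OF assms] by (simp add: extremal_def)

lemma spanning_subdessins_eq: "spanning_subdessins (all_A_dessin P) = sub ` Pow (set (crossings P))"
  by (simp add: spanning_subdessins_def all_A_dessin_def)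

lemma inj_sub: "inj_on sub A"
  by (rule inj_onI) (simp add: spanning_subdessin_def)

lemma kauffman_bracket_eq:
  "kauffman_bracket P = (\<Sum>H\<in>spanning_subdessins (all_A_dessin P). expansion_term (all_A_dessin P) H)"
proof -
  have "(\<Sum>H\<in>spanning_subdessins (all_A_dessin P). expansion_term (all_A_dessin P) H) =
      (\<Sum>F\<in>Pow (set (crossings P)). expansion_term (all_A_dessin P) (sub F))"
    unfolding spanning_subdessins_eq by (simp add: sum.reindex[OF inj_sub])
  also have "\<dots> = (\<Sum>F\<in>Pow (set (crossings P)). A_power (int (length (crossings P)) - 2 * int (card F)) *
      circle_value ^ (card (circles op (state_joins P F)) - 1))"
    by (intro sum.cong refl)
       (simp add: expansion_term_def num_edges_D num_edges_sub num_faces_spanning_subdessin)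
  also have "\<dots> = kauffman_bracket P"
    unfolding kauffman_bracket_def bracket_expansion[OF distinct_crossings] state_joins_def ..
  finally show ?thesis ..
qed

end

theorem theorem6p1:
  fixes P :: "'h diagram" and D :: "('h set, 'h crossing) dessin" and a :: "nat \<Rightarrow> int"
  assumes "connected_projection P"
    and "D = all_A_dessin P"
    and "\<And>l. a l = coefficient (kauffman_bracket P) (exponent_M D - 4 * int l)"
  shows
    "kauffman_bracket P = (\<Sum>H\<in>spanning_subdessins D. expansion_term D H) \<and>
     (\<forall>l. (\<forall>H\<in>spanning_subdessins D. genus H > real l \<longrightarrow>
             coefficient (expansion_term D H) (exponent_M D - 4 * int l) = 0) \<and>
          a l = (\<Sum>H\<in>{H \<in> spanning_subdessins D. genus H \<le> real l}.
                   coefficient (expansion_term D H) (exponent_M D - 4 * int l))) \<and>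
     a 0 = (\<Sum>H\<in>{H \<in> spanning_subdessins D.
                    genus H = 0 \<and> int (num_components H) - int (num_verts D) = 0}.
              (- 1) ^ (num_verts D + num_edges H - 1)) \<and>
     (\<not> has_loop D \<longrightarrow>
        a 0 = (- 1) ^ (num_verts D - 1) \<and>
        {H \<in> spanning_subdessins D.
           genus H = 0 \<and> int (num_components H) - int (num_verts D) = 0}
          = {spanning_subdessin D {}} \<and>
        {H \<in> spanning_subdessins D. coefficient (expansion_term D H) (exponent_M D) \<noteq> 0}
          = {spanning_subdessin D {}})"
proof -
  interpret plane_diagram P by (rule plane_diagram.intro[OF assms(1)])
  let ?S = "spanning_subdessins D" and ?F = "Pow (set (crossings P))"
  let ?top = "{H \<in> ?S. genus H = 0 \<and> int (num_components H) - int (num_verts D) = 0}"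
  let ?c = "\<lambda>l H. coefficient (expansion_term D H) (exponent_M D - 4 * int l)"
  have D: "?S = sub ` ?F" "num_verts D = card (A_circles P)"
    unfolding assms(2) by (rule spanning_subdessins_eq, rule num_verts_D)
  have fin: "finite ?S" by (simp add: D)
  have expansion: "kauffman_bracket P = (\<Sum>H\<in>?S. expansion_term D H)"
    unfolding assms(2) by (rule kauffman_bracket_eq)
  have zero: "?c l H = 0" if "H \<in> ?S" "genus H > real l" for l H
  proof -
    obtain F where "F \<subseteq> set (crossings P)" "H = sub F" using \<open>H \<in> ?S\<close> unfolding D by blast
    with that(2) show ?thesis unfolding assms(2) using coefficient_eq_0_if_genus_gt by blast
  qed
  have total: "a l = (\<Sum>H\<in>?S. ?c l H)" for l
    unfolding assms(3) expansion by (rule lookup_sum)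
  have low_genus: "a l = (\<Sum>H\<in>{H \<in> ?S. genus H \<le> real l}. ?c l H)" for l
    unfolding total
  proof (rule sum.mono_neutral_right[OF fin])
    show "\<forall>H\<in>?S - {H \<in> ?S. genus H \<le> real l}. ?c l H = 0"
    proof
      fix H assume "H \<in> ?S - {H \<in> ?S. genus H \<le> real l}"
      then have "H \<in> ?S" "genus H > real l" by auto
      then show "?c l H = 0" by (rule zero)
    qed
  qed blast
  have top: "?top = sub ` {F \<in> ?F. extremal F}"
    unfolding D by (auto simp: extremal_def)
  have c0: "?c 0 (sub F) = (if extremal F then (- 1) ^ (num_verts D + num_edges (sub F) - 1) else 0)"
    if "F \<in> ?F" for F
    using top_coefficient[of F] that by (simp add: assms(2) num_verts_D num_edges_sub)
  have c0_iff: "?c 0 H \<noteq> 0 \<longleftrightarrow> H \<in> ?top" if "H \<in> ?S" for H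
  proof -
    obtain F where F: "F \<in> ?F" "H = sub F" using \<open>H \<in> ?S\<close> unfolding D by blast
    have "H \<in> ?top \<longleftrightarrow> extremal F"
      unfolding top F(2) using F(1) inj_on_image_mem_iff[OF inj_sub, of F UNIV "{F \<in> ?F. extremal F}"]
      by simp
    then show ?thesis using c0[OF F(1)] F(2) by simp
  qed
  have a0: "a 0 = (\<Sum>H\<in>?top. (- 1) ^ (num_verts D + num_edges H - 1))"
  proof -
    have "a 0 = (\<Sum>H\<in>?top. ?c 0 H)"
      unfolding total
    proof (rule sum.mono_neutral_right[OF fin])
      show "\<forall>H\<in>?S - ?top. ?c 0 H = 0" using c0_iff by blast
    qed blast
    also have "\<dots> = (\<Sum>H\<in>?top. (- 1) ^ (num_verts D + num_edges H - 1))"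
      unfolding top using c0 by (intro sum.cong refl) auto
    finally show ?thesis .
  qed
  moreover have "a 0 = (- 1) ^ (num_verts D - 1) \<and> ?top = {spanning_subdessin D {}} \<and>
      {H \<in> ?S. coefficient (expansion_term D H) (exponent_M D) \<noteq> 0} = {spanning_subdessin D {}}"
    if "\<not> has_loop D"
  proof -
    have "{F \<in> ?F. extremal F} = {{}}"
      using extremal_empty not_extremal_if_no_loop that unfolding assms(2) by blast
    then have t: "?top = {sub {}}" unfolding top by simp
    moreover have "{H \<in> ?S. coefficient (expansion_term D H) (exponent_M D) \<noteq> 0} = ?top"
      using c0_iff by auto
    ultimately show ?thesis
      unfolding a0 t by (simp add: num_edges_sub assms(2))
  qed
  ultimately show ?thesis
    using expansion zero low_genus by blast
qed

end
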